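(* Let $A_1,\dots,A_m$, $A$, $\gamma>0$, $M_\gamma$, $B_\gamma$ and $\sigma_\gamma$ be as follows: $A_j\in\mathbb{C}^{r_j\times n}$, $A=\begin{bmatrix}A_1\\ \vdots\\ A_m\end{bmatrix}$ has full row rank, $D_\gamma=\operatorname{diag}(\gamma I+A_1A_1^*,\dots,\gamma I+A_mA_m^* )$, $L$ is the strictly block lower triangular matrix with $(i,j)$ block $A_iA_j^*$ for $i>j$, $M_\gamma=(D_\gamma+L)^{-1}$, $B_\gamma=I-A^*M_\gamma A$, $R_\gamma=(D_{2\gamma})^{1/2}M_\gamma A$ (with $D_{2\gamma}$ being $D_\gamma$ with $\gamma$ replaced by $2\gamma$), and $\sigma_\gamma$ the smallest nonzero singular value of $R_\gamma$. For data vectors $p=(p_1,\dots,p_m)$ and $\tilde p=(\tilde p_1,\dots,\tilde p_m)$ (with $p_j,\tilde p_j\in\mathbb{C}^{r_j}$), let $q_\gamma^k$ and $\tilde q_\gamma^k$ denote the iterates of the regularized block Kaczmarz method with $q_\gamma^0=\tilde q_\gamma^0=0$: $$q_0=q_\gamma^k,\quad q_j=q_{j-1}+A_j^*(\gamma I+A_jA_j^* )^{-1}(p_j-A_jq_{j-1}),\ j=1,\dots,m,\quad q_\gamma^{k+1}=q_m,$$ (equivalently $q_\gamma^{k+1}=B_\gamma q_\gamma^k+A^*M_\gamma p$), and similarly for $\tilde q_\gamma^k$ with $\tilde p$ in place of $p$. Then for every $k\ge 1$, the error $e^k=\tilde q_\gamma^k-q_\gamma^k$ satisfies $$\|e^k\|\le\left[\frac{1-(1-\sigma_\gamma^2)^{k/2}}{1-(1-\sigma_\gamma^2)^{1/2}}\right]\big\|A^*M_\gamma(\tilde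 p-p)\big\|.$$
   Context: $A^*$ is the conjugate transpose; $\|\cdot\|$ is the Euclidean norm on vectors and the operator 2-norm on matrices; $(D_{2\gamma})^{1/2}$ is the Hermitian positive definite square root. One has $0<\sigma_\gamma\le 1$. *)

theory Defs
  imports "Jordan_Normal_Form.Schur_Decomposition" "Jordan_Normal_Form.DL_Rank"
begin

definition vnorm :: "complex vec \<Rightarrow> real" where
  "vnorm v = sqrt (\<Sum>i<dim_vec v. (cmod (v $ i))^2)"

definition minv :: "complex mat \<Rightarrow> complex mat" where
  "minv S = (THE X. X \<in> carrier_mat (dim_row S) (dim_row S) \<and>
                    S * X = 1\<^sub>m (dim_row S) \<and> X * S = 1\<^sub>m (dim_row S))"

definition herm_pd :: "complex mat \<Rightarrow> bool" where
  "herm_pd X \<longleftrightarrow> X \<in> carrier_mat (dim_row X) (dim_row X) \<and> mat_adjoint X = X \<and>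
     (\<forall>v \<in> carrier_vec (dim_row X). v \<noteq> 0\<^sub>v (dim_row X) \<longrightarrow> 0 < Re ((X *\<^sub>v v) \<bullet>c v))"

definition psd_sqrt :: "complex mat \<Rightarrow> complex mat" where
  "psd_sqrt S = (THE X. X \<in> carrier_mat (dim_row S) (dim_row S) \<and> herm_pd X \<and> X * X = S)"

definition singular_values :: "complex mat \<Rightarrow> real set" where
  "singular_values R = {s. 0 \<le> s \<and> eigenvalue (mat_adjoint R * R) (complex_of_real (s^2))}"

definition min_nonzero_singular_value :: "complex mat \<Rightarrow> real" where
  "min_nonzero_singular_value R = Min {s \<in> singular_values R. s > 0}"

definition stack_mat :: "nat \<Rightarrow> complex mat list \<Rightarrow> complex mat" where
  "stack_mat n As = foldr (\<lambda>B C. B @\<^sub>r C) As (0\<^sub>m 0 n)"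

definition stack_vec :: "complex vec list \<Rightarrow> complex vec" where
  "stack_vec ps = foldr (\<lambda>v w. v @\<^sub>v w) ps (vec 0 (\<lambda>_. 0))"

fun block_diag :: "complex mat list \<Rightarrow> complex mat" where
  "block_diag [] = 0\<^sub>m 0 0"
| "block_diag (B # Bs) = four_block_mat B (0\<^sub>m (dim_row B) (dim_col (block_diag Bs)))
      (0\<^sub>m (dim_row (block_diag Bs)) (dim_col B)) (block_diag Bs)"

text \<open>Index (0-based) of the block containing row index a, for block sizes rs.\<close>
definition blk :: "nat list \<Rightarrow> nat \<Rightarrow> nat" where
  "blk rs a = card {j. j < length rs \<and> sum_list (take (Suc j) rs) \<le> a}"

definition D_mat :: "real \<Rightarrow> complex mat list \<Rightarrow> complex mat" where
  "D_mat \<gamma> As = block_diag (map (\<lambda>B. complex_of_real \<gamma> \<cdot>\<^sub>m 1\<^sub>m (dim_row B) + B * mat_adjoint B) As)"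

definition L_mat :: "nat \<Rightarrow> complex mat list \<Rightarrow> complex mat" where
  "L_mat n As = (let A = stack_mat n As; rs = map dim_row As; G = A * mat_adjoint A in
     mat (dim_row A) (dim_row A) (\<lambda>(a, b). if blk rs b < blk rs a then G $$ (a, b) else 0))"

definition M_mat :: "real \<Rightarrow> nat \<Rightarrow> complex mat list \<Rightarrow> complex mat" where
  "M_mat \<gamma> n As = minv (D_mat \<gamma> As + L_mat n As)"

definition B_mat :: "real \<Rightarrow> nat \<Rightarrow> complex mat list \<Rightarrow> complex mat" where
  "B_mat \<gamma> n As = 1\<^sub>m n - mat_adjoint (stack_mat n As) * M_mat \<gamma> n As * stack_mat n As"

definition R_mat :: "real \<Rightarrow> nat \<Rightarrow> complex mat list \<Rightarrow> complex mat" where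
  "R_mat \<gamma> n As = psd_sqrt (D_mat (2 * \<gamma>) As) * M_mat \<gamma> n As * stack_mat n As"

definition sigma :: "real \<Rightarrow> nat \<Rightarrow> complex mat list \<Rightarrow> real" where
  "sigma \<gamma> n As = min_nonzero_singular_value (R_mat \<gamma> n As)"

definition kaczmarz_sweep :: "real \<Rightarrow> complex mat list \<Rightarrow> complex vec list \<Rightarrow> complex vec \<Rightarrow> complex vec" where
  "kaczmarz_sweep \<gamma> As ps q = foldl (\<lambda>x (B, pj). x + mat_adjoint B *\<^sub>v
      (minv (complex_of_real \<gamma> \<cdot>\<^sub>m 1\<^sub>m (dim_row B) + B * mat_adjoint B) *\<^sub>v (pj - B *\<^sub>v x)))
      q (zip As ps)"

definition kaczmarz_iter :: "real \<Rightarrow> nat \<Rightarrow> complex mat list \<Rightarrow> complex vec list \<Rightarrow> nat \<Rightarrow> complex vec" where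
  "kaczmarz_iter \<gamma> n As ps k = (kaczmarz_sweep \<gamma> As ps ^^ k) (0\<^sub>v n)"

end

theory Submission
  imports Defs "Jordan_Normal_Form.Spectral_Radius" "HOL-Analysis.L2_Norm"
begin

text \<open>
  A sweep started at \<open>q\<close> ends at \<open>q + A\<^sup>* y\<close>, where \<open>y\<close> solves the block triangular system
  \<open>(D\<^sub>\<gamma> + L) y = p - A q\<close> by forward substitution. Hence the errors satisfy
  \<open>e\<^sup>k\<^sup>+\<^sup>1 = B\<^sub>\<gamma> e\<^sup>k + A\<^sup>* M\<^sub>\<gamma> (p' - p)\<close> for the perturbed data \<open>p'\<close>, and they stay in the range of \<open>A\<^sup>*\<close>.
  From \<open>(D\<^sub>\<gamma> + L) + (D\<^sub>\<gamma> + L)\<^sup>* = D\<^sub>2\<^sub>\<gamma> + A A\<^sup>*\<close> one gets \<open>\<parallel>B\<^sub>\<gamma> x\<parallel>\<^sup>2 = \<parallel>x\<parallel>\<^sup>2 - \<parallel>R\<^sub>\<gamma> x\<parallel>\<^sup>2\<close>.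
  As \<open>ker R\<^sub>\<gamma> = ker A\<close> is orthogonal to the range of \<open>A\<^sup>*\<close>, on that range
  \<open>\<parallel>R\<^sub>\<gamma> x\<parallel> \<ge> \<sigma>\<^sub>\<gamma> \<parallel>x\<parallel>\<close>, so \<open>B\<^sub>\<gamma>\<close> contracts by \<open>(1 - \<sigma>\<^sub>\<gamma>\<^sup>2)\<^sup>1\<^sup>/\<^sup>2\<close>
  there, and a geometric sum gives the bound.
\<close>

section \<open>Adjoints and the Euclidean norm\<close>

lemma dim_mat_adjoint [simp]:
  "dim_row (mat_adjoint A) = dim_col A" "dim_col (mat_adjoint A) = dim_row A"
  by (simp_all add: mat_adjoint_def)

lemma mat_adjoint_carrier [simp]:
  "mat_adjoint A \<in> carrier_mat m n \<longleftrightarrow> A \<in> carrier_mat n m"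
  unfolding carrier_mat_def by auto

lemma index_mat_adjoint [simp]:
  "i < dim_col A \<Longrightarrow> j < dim_row A \<Longrightarrow> mat_adjoint A $$ (i, j) = conjugate (A $$ (j, i))"
  by (simp add: mat_adjoint_def mat_of_rows_def)

lemma mat_adjoint_adjoint [simp]: "mat_adjoint (mat_adjoint A) = A"
  by (rule eq_matI) auto

lemma mat_adjoint_one [simp]: "mat_adjoint (1\<^sub>m n :: complex mat) = 1\<^sub>m n"
  by (rule eq_matI) auto

lemma mat_adjoint_minus:
  fixes A B :: "complex mat"
  assumes "A \<in> carrier_mat m n" "B \<in> carrier_mat m n"
  shows "mat_adjoint (A - B) = mat_adjoint A - mat_adjoint B"
  using assms by (intro eq_matI) auto

lemma mat_adjoint_mult:
  fixes A B :: "complex mat"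
  assumes "A \<in> carrier_mat m n" "B \<in> carrier_mat n l"
  shows "mat_adjoint (A * B) = mat_adjoint B * mat_adjoint A"
  using assms by (intro eq_matI) (auto simp: scalar_prod_def mult.commute)

lemma mat_adjoint_diag_real:
  "mat_adjoint (mat_diag n (\<lambda>i. complex_of_real (d i))) = mat_diag n (\<lambda>i. complex_of_real (d i))"
  by (rule eq_matI) (auto simp: mat_diag_def)

lemma cscalar_prod_adjoint:
  fixes A :: "complex mat"
  assumes "A \<in> carrier_mat m n" "v \<in> carrier_vec n" "w \<in> carrier_vec m"
  shows "(A *\<^sub>v v) \<bullet>c w = v \<bullet>c (mat_adjoint A *\<^sub>v w)"
proof -
  have "(A *\<^sub>v v) \<bullet>c w = (\<Sum>i<m. \<Sum>j<n. A $$ (i, j) * v $ j * cnj (w $ i))"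
    using assms by (simp add: scalar_prod_def sum_distrib_right lessThan_atLeast0)
  also have "\<dots> = (\<Sum>j<n. \<Sum>i<m. A $$ (i, j) * v $ j * cnj (w $ i))"
    by (rule sum.swap)
  also have "\<dots> = v \<bullet>c (mat_adjoint A *\<^sub>v w)"
    using assms by (simp add: scalar_prod_def sum_distrib_left lessThan_atLeast0 ac_simps)
  finally show ?thesis .
qed

lemma cscalar_prod_commute:
  fixes v w :: "complex vec"
  assumes "v \<in> carrier_vec n" "w \<in> carrier_vec n"
  shows "w \<bullet>c v = cnj (v \<bullet>c w)"
  using assms by (simp add: scalar_prod_def mult.commute)

lemma vnorm_sq: "complex_of_real ((vnorm v)\<^sup>2) = v \<bullet>c v"
proof -
  have "complex_of_real ((vnorm v)\<^sup>2) = (\<Sum>i<dim_vec v. complex_of_real ((cmod (v $ i))\<^sup>2))"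
    unfolding vnorm_def by (subst real_sqrt_pow2) (simp_all add: sum_nonneg)
  then show ?thesis
    by (simp only: complex_norm_square) (simp add: scalar_prod_def lessThan_atLeast0)
qed

lemma vnorm_sq_Re: "(vnorm v)\<^sup>2 = Re (v \<bullet>c v)"
  by (metis Re_complex_of_real vnorm_sq)

lemma vnorm_nonneg [simp]: "0 \<le> vnorm v"
  by (simp add: vnorm_def sum_nonneg)

lemma vnorm_eq_0_iff:
  assumes "v \<in> carrier_vec n"
  shows "vnorm v = 0 \<longleftrightarrow> v = 0\<^sub>v n"
  using conjugate_square_eq_0_vec[OF assms] vnorm_sq[of v] by auto

text \<open>Gives access to \<open>L2_set\<close>, whose Minkowski inequality yields the triangle
  inequality for \<open>vnorm\<close>.\<close>

lemma vnorm_L2: "vnorm v = L2_set (\<lambda>i. cmod (v $ i)) {..<dim_vec v}"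
  by (simp add: vnorm_def L2_set_def)

lemma vnorm_triangle:
  assumes "v \<in> carrier_vec n" "w \<in> carrier_vec n"
  shows "vnorm (v + w) \<le> vnorm v + vnorm w"
proof -
  have "vnorm (v + w) \<le> L2_set (\<lambda>i. cmod (v $ i) + cmod (w $ i)) {..<n}"
    using assms by (auto simp: vnorm_L2 norm_triangle_ineq intro!: L2_set_mono)
  also have "\<dots> \<le> vnorm v + vnorm w"
    using assms L2_set_triangle_ineq by (auto simp: vnorm_L2)
  finally show ?thesis .
qed

section \<open>The spectral theorem for Hermitian matrices\<close>

text \<open>A Householder reflection \<open>Q = 1 - c w w\<^sup>*\<close> with
  \<open>w = v - unit_vec n 0\<close> and \<open>c = 2 / (w \<bullet>c w)\<close>. It moves
  \<open>v\<close> to the first unit vector because \<open>v \<bullet>c w\<close> is half of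
  \<open>w \<bullet>c w\<close>; for complex \<open>v\<close> this relies on \<open>v $ 0\<close>
  being real. If \<open>v\<close> is that unit vector already, \<open>w\<close> vanishes and the
  identity serves.\<close>

lemma ex_unitary_reflection:
  fixes v :: "complex vec"
  assumes v: "v \<in> carrier_vec n" and n: "0 < n" and v1: "v \<bullet>c v = 1" and v0: "v $ 0 \<in> \<real>"
  shows "\<exists>Q \<in> carrier_mat n n. mat_adjoint Q = Q \<and> Q * Q = 1\<^sub>m n \<and> Q *\<^sub>v v = unit_vec n 0"
proof (cases "v = unit_vec n 0")
  case True
  then show ?thesis by (intro bexI[of _ "1\<^sub>m n"]) auto
next
  case False
  define w where "w = v - unit_vec n 0"
  have w: "w \<in> carrier_vec n" using v by (simp add: w_def)
  define s where "s = (\<Sum>k<n. w $ k * cnj (w $ k))"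
  have cn: "cnj (v $ 0) = v $ 0" using v0 by (simp add: Reals_cnj_iff)
  have vv: "(\<Sum>k<n. v $ k * cnj (v $ k)) = 1"
    using v1 v by (simp add: scalar_prod_def lessThan_atLeast0)
  have wi: "w $ k = v $ k - (if k = 0 then 1 else 0)" if "k < n" for k
    using that v by (simp add: w_def unit_vec_def)
  have "(\<Sum>k<n. v $ k * cnj (w $ k))
      = (\<Sum>k<n. v $ k * cnj (v $ k) - (if k = 0 then v $ 0 else 0))"
    by (rule sum.cong) (auto simp: wi algebra_simps)
  then have vw: "(\<Sum>k<n. v $ k * cnj (w $ k)) = 1 - v $ 0"
    using n by (simp add: sum_subtractf vv)
  have "s = (\<Sum>k<n. v $ k * cnj (w $ k) - (if k = 0 then v $ 0 - 1 else 0))"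
    unfolding s_def by (rule sum.cong) (auto simp: wi algebra_simps cn)
  then have s: "s = 2 * (1 - v $ 0)"
    using n by (simp add: sum_subtractf vw)
  have s0: "s \<noteq> 0"
  proof
    assume "s = 0"
    then have "w \<bullet>c w = 0" using w by (simp add: s_def scalar_prod_def lessThan_atLeast0)
    then have "w = 0\<^sub>v n" using conjugate_square_eq_0_vec[OF w] by simp
    then have "w $ i = 0" if "i < n" for i using that by simp
    then have "v = unit_vec n 0"
      using v wi by (intro eq_vecI) (auto simp: unit_vec_def)
    with False show False by simp
  qed
  define c where "c = 2 / s"
  have cs: "c * s = 2" using s0 by (simp add: c_def)
  have cvw: "c * (\<Sum>k<n. v $ k * cnj (w $ k)) = 1"
    using s s0 by (simp add: vw c_def)
  have cc: "cnj c = c"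
    by (simp add: c_def s cn)
  define Q where "Q = mat n n (\<lambda>(i, j). (if i = j then 1 else 0) - c * (w $ i * cnj (w $ j)))"
  have Q: "Q \<in> carrier_mat n n" by (simp add: Q_def)
  have "mat_adjoint Q = Q"
    by (rule eq_matI) (auto simp: Q_def cc)
  moreover have "Q * Q = 1\<^sub>m n"
  proof (rule eq_matI)
    fix i j assume "i < dim_row (1\<^sub>m n :: complex mat)" "j < dim_col (1\<^sub>m n :: complex mat)"
    then have i: "i < n" and j: "j < n" by simp_all
    have "(Q * Q) $$ (i, j) = (\<Sum>k<n. Q $$ (i, k) * Q $$ (k, j))"
      using i j Q by (simp add: scalar_prod_def lessThan_atLeast0)
    \<comment> \<open>The square expands to
      \<open>1 - 2 c w w\<^sup>* + c\<^sup>2 s w w\<^sup>*\<close>; as \<open>c * s = 2\<close>, the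
      last two terms cancel.\<close>
    also have "\<dots> = (\<Sum>k<n. (if k = i then (if i = j then 1 else 0) - c * (w $ i * cnj (w $ j)) else 0)
        - (if k = j then c * (w $ i * cnj (w $ j)) else 0)
        + c * c * (w $ i * cnj (w $ j)) * (w $ k * cnj (w $ k)))"
      using i j by (intro sum.cong) (auto simp: Q_def algebra_simps)
    also have "\<dots> = (if i = j then 1 else 0) - c * (w $ i * cnj (w $ j))
        - c * (w $ i * cnj (w $ j)) + c * (c * s) * (w $ i * cnj (w $ j))"
      using i j by (simp add: sum.distrib sum_subtractf sum_distrib_left[symmetric] s_def)
    also have "\<dots> = 1\<^sub>m n $$ (i, j)" using i j by (simp add: cs)
    finally show "(Q * Q) $$ (i, j) = 1\<^sub>m n $$ (i, j)" .
  qed (simp_all add: Q_def)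
  moreover have "Q *\<^sub>v v = unit_vec n 0"
  proof (rule eq_vecI)
    fix i assume "i < dim_vec (unit_vec n 0 :: complex vec)"
    then have i: "i < n" by simp
    have "(Q *\<^sub>v v) $ i = (\<Sum>k<n. Q $$ (i, k) * v $ k)"
      using i Q v by (simp add: scalar_prod_def lessThan_atLeast0)
    also have "\<dots> = (\<Sum>k<n. (if k = i then v $ i else 0) - c * w $ i * (v $ k * cnj (w $ k)))"
      using i by (intro sum.cong) (auto simp: Q_def algebra_simps)
    also have "\<dots> = v $ i - (c * (\<Sum>k<n. v $ k * cnj (w $ k))) * w $ i"
      using i by (simp add: sum_subtractf sum_distrib_left[symmetric])
    also have "\<dots> = unit_vec n 0 $ i" using i wi[OF i] by (simp add: cvw unit_vec_def)
    finally show "(Q *\<^sub>v v) $ i = unit_vec n 0 $ i" .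
  qed (simp add: Q_def)
  ultimately show ?thesis using Q by blast
qed

lemma mat_adjoint_four_block_diag:
  fixes A D :: "complex mat"
  assumes "A \<in> carrier_mat k l" "D \<in> carrier_mat m n"
  shows "mat_adjoint (four_block_mat A (0\<^sub>m k n) (0\<^sub>m m l) D)
       = four_block_mat (mat_adjoint A) (0\<^sub>m l m) (0\<^sub>m n k) (mat_adjoint D)"
  using assms by (intro eq_matI) auto

lemma mult_four_block_diag:
  fixes A1 D1 :: "complex mat"
  assumes "A1 \<in> carrier_mat k k" "D1 \<in> carrier_mat n n" "A2 \<in> carrier_mat k k" "D2 \<in> carrier_mat n n"
  shows "four_block_mat A1 (0\<^sub>m k n) (0\<^sub>m n k) D1 * four_block_mat A2 (0\<^sub>m k n) (0\<^sub>m n k) D2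
       = four_block_mat (A1 * A2) (0\<^sub>m k n) (0\<^sub>m n k) (D1 * D2)"
  by (subst mult_four_block_mat[of _ k k _ n _ n _ _ k _ n], insert assms) auto

text \<open>Over the complex numbers the spectrum is nonempty, and an eigenvector can be rescaled in
  length and phase. The real first entry is what \<open>ex_unitary_reflection\<close> asks
  for.\<close>

lemma ex_unit_eigenvector:
  fixes H :: "complex mat"
  assumes H: "H \<in> carrier_mat n n" and n: "0 < n"
  shows "\<exists>e. \<exists>v \<in> carrier_vec n. v \<bullet>c v = 1 \<and> v $ 0 \<in> \<real> \<and> H *\<^sub>v v = e \<cdot>\<^sub>v v"
proof -
  obtain e x where "eigenvector H x e"
    using spectrum_non_empty[OF H n] by (auto simp: spectrum_def eigenvalue_def)
  then have x: "x \<in> carrier_vec n" and x0: "x \<noteq> 0\<^sub>v n" and Hx: "H *\<^sub>v x = e \<cdot>\<^sub>v x"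
    using H by (auto simp: eigenvector_def)
  \<comment> \<open>A factor of modulus 1 that turns \<open>x $ 0\<close> into its absolute value;
    it is 1 if that entry vanishes.\<close>
  define a where "a = (if x $ 0 = 0 then 1 else cnj (x $ 0)) / cmod (if x $ 0 = 0 then 1 else x $ 0)"
  define c where "c = a / vnorm x"
  define v where "v = c \<cdot>\<^sub>v x"
  have v: "v \<in> carrier_vec n" using x by (simp add: v_def)
  have aa: "a * cnj a = 1"
    by (auto simp: a_def complex_norm_square[symmetric] mult.commute power2_eq_square)
  have nx: "vnorm x \<noteq> 0" using vnorm_eq_0_iff[OF x] x0 by simp
  have "v \<bullet>c v = c * cnj c * (x \<bullet>c x)"
    using x by (simp add: v_def conjugate_smult_vec)
  also have "\<dots> = (a * cnj a) * ((x \<bullet>c x) / (complex_of_real (vnorm x))\<^sup>2)"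
    by (simp add: c_def power2_eq_square)
  also have "\<dots> = 1"
    using vnorm_sq[of x, symmetric] nx by (simp add: aa)
  finally have "v \<bullet>c v = 1" .
  moreover have "cnj (x $ 0) * x $ 0 = complex_of_real ((cmod (x $ 0))\<^sup>2)"
    using complex_norm_square[of "x $ 0"] by (simp add: mult.commute)
  then have "a * x $ 0 \<in> \<real>"
    by (auto simp: a_def)
  then have "v $ 0 \<in> \<real>"
    using x n by (auto simp: v_def c_def)
  moreover have "H *\<^sub>v v = e \<cdot>\<^sub>v v"
    using H x by (simp add: v_def mult_mat_vec Hx smult_smult_assoc mult.commute)
  ultimately show ?thesis using v by blast
qed

text \<open>Deflation, by induction on the size. A reflection moves a unit eigenvector to the first
  unit vector. The conjugated matrix has the eigenvalue in its corner, zeros in the rest of the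
  first row and column, and a Hermitian remaining block to which the induction hypothesis
  applies.\<close>

lemma hermitian_spectral:
  fixes H :: "complex mat"
  assumes "H \<in> carrier_mat n n" "mat_adjoint H = H"
  shows "\<exists>U \<in> carrier_mat n n. \<exists>d. mat_adjoint U * U = 1\<^sub>m n \<and> U * mat_adjoint U = 1\<^sub>m n \<and>
           H = U * mat_diag n (\<lambda>i. complex_of_real (d i)) * mat_adjoint U"
  using assms
proof (induction n arbitrary: H)
  case 0
  then show ?case
    by (intro bexI[of _ "1\<^sub>m 0"] exI[of _ "\<lambda>_. 0"]) (auto intro!: eq_matI)
next
  case (Suc n)
  let ?N = "Suc n"
  note H = Suc.prems(1) and adjH = Suc.prems(2)
  obtain e v where v: "v \<in> carrier_vec ?N" "v \<bullet>c v = 1" "v $ 0 \<in> \<real>" and Hv: "H *\<^sub>v v = e \<cdot>\<^sub>v v"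
    using ex_unit_eigenvector[OF H] by auto
  obtain Q where Q: "Q \<in> carrier_mat ?N ?N" and adjQ: "mat_adjoint Q = Q"
    and QQ: "Q * Q = 1\<^sub>m ?N" and Qv: "Q *\<^sub>v v = unit_vec ?N 0"
    using ex_unitary_reflection[OF v(1) _ v(2,3)] by auto
  \<comment> \<open>Since \<open>Q\<close> is its own adjoint and its own inverse, this is a unitary
    conjugate of \<open>H\<close> and again Hermitian.\<close>
  define K where "K = Q * (H * Q)"
  have K: "K \<in> carrier_mat ?N ?N" using Q H by (simp add: K_def)
  have adjK: "mat_adjoint K = K"
    using Q H by (simp add: K_def adjQ adjH mat_adjoint_mult[of _ ?N ?N _ ?N])
  have "Q *\<^sub>v unit_vec ?N 0 = (Q * Q) *\<^sub>v v"
    using Q v by (simp add: Qv)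
  then have Qe: "Q *\<^sub>v unit_vec ?N 0 = v" using QQ v by simp
  have "K *\<^sub>v unit_vec ?N 0 = Q *\<^sub>v (H *\<^sub>v (Q *\<^sub>v unit_vec ?N 0))"
    using Q H by (simp add: K_def assoc_mult_mat_vec[of _ ?N ?N _ ?N])
  also have "\<dots> = e \<cdot>\<^sub>v unit_vec ?N 0"
    using Q v by (simp add: Qe Hv mult_mat_vec Qv)
  finally have Ke: "K *\<^sub>v unit_vec ?N 0 = e \<cdot>\<^sub>v unit_vec ?N 0" .
  have K0: "K $$ (i, 0) = (if i = 0 then e else 0)" if "i < ?N" for i
    using arg_cong[OF Ke, of "\<lambda>x. x $ i"] that K by auto
  have K0': "K $$ (0, i) = (if i = 0 then cnj e else 0)" if "i < ?N" for i
  proof -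
    have "K $$ (0, i) = mat_adjoint K $$ (0, i)" by (simp add: adjK)
    also have "\<dots> = cnj (K $$ (i, 0))" using that K by (subst index_mat_adjoint) auto
    finally show ?thesis using K0[OF that] by simp
  qed
  \<comment> \<open>The corner entry of the Hermitian \<open>K\<close> equals its own conjugate, so
    the eigenvalue is real.\<close>
  have "e = cnj e" using K0[of 0] K0'[of 0] by simp
  then obtain r where r: "e = complex_of_real r" by (metis Reals_cases Reals_cnj_iff)
  define K' where "K' = mat n n (\<lambda>(i, j). K $$ (Suc i, Suc j))"
  have K': "K' \<in> carrier_mat n n" by (simp add: K'_def)
  have herm: "K $$ (Suc i, Suc j) = cnj (K $$ (Suc j, Suc i))" if "i < n" "j < n" for i j
  proof -
    have "K $$ (Suc i, Suc j) = mat_adjoint K $$ (Suc i, Suc j)" by (simp only: adjK)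
    also have "\<dots> = cnj (K $$ (Suc j, Suc i))" using that K by (subst index_mat_adjoint) auto
    finally show ?thesis .
  qed
  have "mat_adjoint K' = K'"
  proof (rule eq_matI)
    fix i j assume "i < dim_row K'" "j < dim_col K'"
    then show "mat_adjoint K' $$ (i, j) = K' $$ (i, j)"
      using herm[of i j] by (simp add: K'_def)
  qed (simp_all add: K'_def)
  from Suc.IH[OF K' this] obtain V d where V: "V \<in> carrier_mat n n"
    and VV: "mat_adjoint V * V = 1\<^sub>m n" "V * mat_adjoint V = 1\<^sub>m n"
    and K'eq: "K' = V * mat_diag n (\<lambda>i. complex_of_real (d i)) * mat_adjoint V"
    by blast
  let ?E = "mat 1 1 (\<lambda>_. complex_of_real r)"
  let ?b = "\<lambda>A D. four_block_mat A (0\<^sub>m 1 n) (0\<^sub>m n 1) D :: complex mat"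
  have Kb: "K = ?b ?E K'"
  proof (rule eq_matI)
    fix i j assume "i < dim_row (?b ?E K')" "j < dim_col (?b ?E K')"
    then show "K $$ (i, j) = ?b ?E K' $$ (i, j)"
      using K0[of i] K0'[of j] r by (cases i; cases j) (auto simp: K'_def)
  qed (use K in \<open>auto simp: K'_def\<close>)
  define F where "F = ?b (1\<^sub>m 1) V"
  have F: "F \<in> carrier_mat ?N ?N" using four_block_carrier_mat[of "1\<^sub>m 1" 1 1 V n n] V by (simp add: F_def)
  have adjF: "mat_adjoint F = ?b (1\<^sub>m 1) (mat_adjoint V)"
    using V by (simp add: F_def mat_adjoint_four_block_diag)
  have FF: "mat_adjoint F * F = 1\<^sub>m ?N" "F * mat_adjoint F = 1\<^sub>m ?N"
    using V VV unfolding adjF unfolding F_def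
    by (simp_all add: mult_four_block_diag)
  let ?dd = "\<lambda>i. case i of 0 \<Rightarrow> r | Suc j \<Rightarrow> d j"
  let ?D = "mat_diag ?N (\<lambda>i. complex_of_real (?dd i))"
  have D: "?D = ?b ?E (mat_diag n (\<lambda>i. complex_of_real (d i)))"
    by (rule eq_matI) (auto simp: mat_diag_def split: nat.splits)
  have Dc: "?D \<in> carrier_mat ?N ?N" by simp
  have KF: "K = F * ?D * mat_adjoint F"
    unfolding Kb D adjF unfolding F_def K'eq using V
    by (simp add: mult_four_block_diag)
  \<comment> \<open>\<open>F\<close> diagonalises \<open>K = Q * (H * Q)\<close>, so
    \<open>Q * F\<close> diagonalises \<open>H\<close>.\<close>
  define U where "U = Q * F"
  have U: "U \<in> carrier_mat ?N ?N" using Q F by (simp add: U_def)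
  have F': "mat_adjoint F \<in> carrier_mat ?N ?N" using F by simp
  have adjU: "mat_adjoint U = mat_adjoint F * Q"
    using Q F by (simp add: U_def mat_adjoint_mult[of _ ?N ?N] adjQ)
  have "mat_adjoint U * U = mat_adjoint F * ((Q * Q) * F)"
    unfolding adjU using Q F F' by (simp add: U_def assoc_mult_mat[of _ ?N ?N _ ?N _ ?N])
  then have 1: "mat_adjoint U * U = 1\<^sub>m ?N" using QQ F FF by simp
  have 2: "U * mat_adjoint U = 1\<^sub>m ?N"
    by (rule mat_mult_left_right_inverse[OF _ U 1]) (use U in simp)
  have "U * ?D * mat_adjoint U = Q * (F * ?D * mat_adjoint F) * Q"
    unfolding adjU using Q F F' Dc
    by (simp add: U_def assoc_mult_mat[of _ ?N ?N _ ?N _ ?N] mult_carrier_mat[of _ ?N ?N _ ?N])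
  also have "\<dots> = (Q * Q) * H * (Q * Q)"
    unfolding KF[symmetric] using Q H
    by (simp add: K_def assoc_mult_mat[of _ ?N ?N _ ?N _ ?N] mult_carrier_mat[of _ ?N ?N _ ?N])
  also have "\<dots> = H" using QQ H by simp
  finally have "H = U * ?D * mat_adjoint U" ..
  then show ?case using U 1 2 by blast
qed

section \<open>Square roots and singular values\<close>

text \<open>Moving \<open>U\<close> across the inner product leaves the diagonal matrix paired with
  the coordinate vector \<open>y\<close>.\<close>

lemma diag_quadratic_form:
  fixes U :: "complex mat" and d :: "nat \<Rightarrow> real"
  assumes U: "U \<in> carrier_mat n n" and x: "x \<in> carrier_vec n"
  defines "y \<equiv> mat_adjoint U *\<^sub>v x"
  shows "(U * mat_diag n (\<lambda>i. complex_of_real (d i)) * mat_adjoint U *\<^sub>v x) \<bullet>c x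
       = complex_of_real (\<Sum>i<n. d i * (cmod (y $ i))\<^sup>2)"
proof -
  let ?D = "mat_diag n (\<lambda>i. complex_of_real (d i))"
  have y: "y \<in> carrier_vec n" using U x by (simp add: y_def mult_mat_vec_carrier[of _ n n])
  have U': "mat_adjoint U \<in> carrier_mat n n" using U by simp
  have D: "?D \<in> carrier_mat n n" by simp
  have Dy: "?D *\<^sub>v y \<in> carrier_vec n" using D y by (rule mult_mat_vec_carrier)
  have Dyi: "(?D *\<^sub>v y) $ i = d i * y $ i" if "i < n" for i
  proof -
    have "(?D *\<^sub>v y) $ i = (\<Sum>j<n. (if i = j then complex_of_real (d j) else 0) * y $ j)"
      using that y by (simp add: mat_diag_def scalar_prod_def lessThan_atLeast0)
    also have "\<dots> = (\<Sum>j<n. (if j = i then complex_of_real (d i) * y $ i else 0))"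
      by (rule sum.cong) auto
    also have "\<dots> = d i * y $ i" using that by simp
    finally show ?thesis .
  qed
  have "(U * ?D * mat_adjoint U *\<^sub>v x) \<bullet>c x = (U *\<^sub>v (?D *\<^sub>v y)) \<bullet>c x"
    using U x U' D by (simp add: y_def assoc_mult_mat_vec[of _ n n _ n] mult_carrier_mat[of _ n n _ n])
  also have "\<dots> = (?D *\<^sub>v y) \<bullet>c y"
    unfolding y_def[symmetric] cscalar_prod_adjoint[OF U Dy x] ..
  also have "\<dots> = (\<Sum>i<n. complex_of_real (d i) * (y $ i * cnj (y $ i)))"
    using y Dyi by (simp add: scalar_prod_def lessThan_atLeast0 mult.assoc)
  also have "\<dots> = complex_of_real (\<Sum>i<n. d i * (cmod (y $ i))\<^sup>2)"
    by (simp add: complex_norm_square[symmetric] del: of_real_power)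
  finally show ?thesis .
qed

text \<open>Read column by column, \<open>U\<^sup>* U = 1\<close> says that the adjoint sends the
  columns of \<open>U\<close> to the unit vectors. So these columns are nonzero, and they are
  eigenvectors of the diagonalised matrix.\<close>

lemma unitary_col:
  fixes U :: "complex mat"
  assumes U: "U \<in> carrier_mat n n" and UU: "mat_adjoint U * U = 1\<^sub>m n" and i: "i < n"
  shows "mat_adjoint U *\<^sub>v col U i = unit_vec n i" "col U i \<noteq> 0\<^sub>v n"
    "U * mat_diag n d * mat_adjoint U *\<^sub>v col U i = d i \<cdot>\<^sub>v col U i"
proof -
  have U': "mat_adjoint U \<in> carrier_mat n n" using U by simp
  have "mat_adjoint U *\<^sub>v col U i = col (mat_adjoint U * U) i"
    using col_mult2[OF U' U i] by simp
  then show 1: "mat_adjoint U *\<^sub>v col U i = unit_vec n i" using i by (simp add: UU)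
  show "col U i \<noteq> 0\<^sub>v n"
  proof
    assume "col U i = 0\<^sub>v n"
    then have "mat_adjoint U *\<^sub>v col U i = 0\<^sub>v n" using U' by (auto intro!: eq_vecI)
    then have "unit_vec n i $ i = (0\<^sub>v n $ i :: complex)" using 1 by simp
    then show False using i by simp
  qed
  have 2: "mat_diag n d *\<^sub>v unit_vec n i = d i \<cdot>\<^sub>v unit_vec n i"
    using i by (intro eq_vecI) (auto simp: mat_diag_def)
  have 3: "U *\<^sub>v unit_vec n i = col U i" using U i by (intro eq_vecI) auto
  have "U * mat_diag n d * mat_adjoint U *\<^sub>v col U i = U *\<^sub>v (mat_diag n d *\<^sub>v (mat_adjoint U *\<^sub>v col U i))"
    using U U' i by (simp add: assoc_mult_mat_vec[of _ n n _ n] mult_carrier_mat[of _ n n _ n] mult_mat_vec_carrier[of _ n n])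
  also have "\<dots> = d i \<cdot>\<^sub>v col U i"
    using U by (simp add: 1 2 mult_mat_vec[of _ n n] 3)
  finally show "U * mat_diag n d * mat_adjoint U *\<^sub>v col U i = d i \<cdot>\<^sub>v col U i" .
qed

text \<open>Parseval's identity: as \<open>U\<close> undoes its adjoint, passing to coordinates
  preserves \<open>x \<bullet>c x\<close>.\<close>

lemma unitary_vnorm:
  fixes U :: "complex mat"
  assumes U: "U \<in> carrier_mat n n" and UU: "U * mat_adjoint U = 1\<^sub>m n" and x: "x \<in> carrier_vec n"
  shows "(\<Sum>i<n. (cmod ((mat_adjoint U *\<^sub>v x) $ i))\<^sup>2) = (vnorm x)\<^sup>2"
proof -
  let ?y = "mat_adjoint U *\<^sub>v x"
  have y: "?y \<in> carrier_vec n" using U x by (simp add: mult_mat_vec_carrier[of _ n n])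
  have "?y \<bullet>c ?y = (U *\<^sub>v ?y) \<bullet>c x"
    using cscalar_prod_adjoint[OF U y x] ..
  also have "U *\<^sub>v ?y = x"
    using U x assoc_mult_mat_vec[of U n n "mat_adjoint U" n x] by (simp add: UU)
  finally have "(vnorm ?y)\<^sup>2 = (vnorm x)\<^sup>2" by (simp add: vnorm_sq_Re)
  then show ?thesis using U by (simp add: vnorm_def sum_nonneg)
qed

text \<open>Supplies the uniqueness behind the definite description in \<open>psd_sqrt\<close>. The
  difference of two roots is Hermitian, hence diagonalisable, so it suffices that all its
  eigenvalues vanish.\<close>

lemma hermitian_square_root_unique:
  assumes X: "X \<in> carrier_mat n n" "herm_pd X" and Y: "Y \<in> carrier_mat n n" "herm_pd Y"
    and eq: "X * X = Y * Y"
  shows "X = Y"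
proof -
  define Z where "Z = X - Y"
  have Z: "Z \<in> carrier_mat n n" using X Y by (simp add: Z_def minus_carrier_mat)
  have adjZ: "mat_adjoint Z = Z"
    using X Y mat_adjoint_minus[OF X(1) Y(1)] by (simp add: Z_def herm_pd_def)
  obtain U d where U: "U \<in> carrier_mat n n" and UU: "mat_adjoint U * U = 1\<^sub>m n"
    and Zeq: "Z = U * mat_diag n (\<lambda>i. complex_of_real (d i)) * mat_adjoint U"
    using hermitian_spectral[OF Z adjZ] by blast
  have d0: "d i = 0" if i: "i < n" for i
  proof -
    define v where "v = col U i"
    have v: "v \<in> carrier_vec n" using U i by (simp add: v_def)
    have v0: "v \<noteq> 0\<^sub>v n" using unitary_col(2)[OF U UU i] by (simp add: v_def)
    have Zv: "Z *\<^sub>v v = complex_of_real (d i) \<cdot>\<^sub>v v"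
      using unitary_col(3)[OF U UU i] by (simp add: v_def Zeq)
    have Xv: "X *\<^sub>v v \<in> carrier_vec n" and Yv: "Y *\<^sub>v v \<in> carrier_vec n"
      using X Y v by (simp_all add: mult_mat_vec_carrier[of _ n n])
    \<comment> \<open>\<open>X Z + Z Y = X\<^sup>2 - Y\<^sup>2 = 0\<close>, and pairing with an eigenvector of \<open>Z\<close> makes its eigenvalue vanish.\<close>
    have "X *\<^sub>v (Z *\<^sub>v v) + Z *\<^sub>v (Y *\<^sub>v v) = X *\<^sub>v (X *\<^sub>v v) - Y *\<^sub>v (Y *\<^sub>v v)"
    proof -
      have "X *\<^sub>v (Z *\<^sub>v v) = X *\<^sub>v (X *\<^sub>v v) - X *\<^sub>v (Y *\<^sub>v v)"
        unfolding Z_def minus_mult_distrib_mat_vec[OF X(1) Y(1) v]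
        by (rule mult_minus_distrib_mat_vec[OF X(1) Xv Yv])
      moreover have "Z *\<^sub>v (Y *\<^sub>v v) = X *\<^sub>v (Y *\<^sub>v v) - Y *\<^sub>v (Y *\<^sub>v v)"
        unfolding Z_def by (rule minus_mult_distrib_mat_vec[OF X(1) Y(1) Yv])
      ultimately show ?thesis
        using X Y by (intro eq_vecI) auto
    qed
    also have "X *\<^sub>v (X *\<^sub>v v) = Y *\<^sub>v (Y *\<^sub>v v)"
      using assoc_mult_mat_vec[OF X(1) X(1) v] assoc_mult_mat_vec[OF Y(1) Y(1) v] eq by simp
    finally have "X *\<^sub>v (Z *\<^sub>v v) + Z *\<^sub>v (Y *\<^sub>v v) = 0\<^sub>v n"
      using Y by (auto simp: mult_mat_vec_carrier[of _ n n])
    then have 0: "(X *\<^sub>v (Z *\<^sub>v v) + Z *\<^sub>v (Y *\<^sub>v v)) \<bullet>c v = 0" using v by simp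
    have XZ: "X *\<^sub>v (Z *\<^sub>v v) = complex_of_real (d i) \<cdot>\<^sub>v (X *\<^sub>v v)"
      using X v by (simp add: Zv mult_mat_vec[of _ n n])
    have ZY: "(Z *\<^sub>v (Y *\<^sub>v v)) \<bullet>c v = d i * ((Y *\<^sub>v v) \<bullet>c v)"
      using cscalar_prod_adjoint[OF Z Yv v] Yv v by (simp add: adjZ Zv conjugate_smult_vec)
    have "complex_of_real (d i) * ((X *\<^sub>v v) \<bullet>c v + (Y *\<^sub>v v) \<bullet>c v) = 0"
      using 0 Z Xv Yv v
      by (simp add: XZ ZY add_scalar_prod_distrib[of _ n] mult_mat_vec_carrier[of _ n n] algebra_simps)
    moreover have "0 < Re ((X *\<^sub>v v) \<bullet>c v + (Y *\<^sub>v v) \<bullet>c v)"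
      using X Y v v0 by (auto simp: herm_pd_def intro!: add_pos_pos)
    ultimately show ?thesis
      by (metis less_irrefl mult_eq_0_iff of_real_eq_0_iff zero_complex.simps(1))
  qed
  have D0: "mat_diag n (\<lambda>i. complex_of_real (d i)) = 0\<^sub>m n n"
    by (rule eq_matI) (auto simp: mat_diag_def d0)
  have "Z = 0\<^sub>m n n" using U unfolding Zeq D0 by simp
  then have "(X - Y) $$ (i, j) = 0" if "i < n" "j < n" for i j
    using that by (simp add: Z_def)
  then show ?thesis using X Y by (intro eq_matI) auto
qed

text \<open>A root exists by taking square roots of the eigenvalues, which are positive by
  definiteness. Together with uniqueness this determines the definite description in
  \<open>psd_sqrt\<close>.\<close>

lemma psd_sqrt:
  assumes S: "S \<in> carrier_mat n n" and pd: "herm_pd S"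
  shows "psd_sqrt S \<in> carrier_mat n n" "herm_pd (psd_sqrt S)" "psd_sqrt S * psd_sqrt S = S"
proof -
  have "mat_adjoint S = S" using pd by (simp add: herm_pd_def)
  from hermitian_spectral[OF S this] obtain U d where U: "U \<in> carrier_mat n n"
    and UU: "mat_adjoint U * U = 1\<^sub>m n" "U * mat_adjoint U = 1\<^sub>m n"
    and Seq: "S = U * mat_diag n (\<lambda>i. complex_of_real (d i)) * mat_adjoint U" by blast
  have U': "mat_adjoint U \<in> carrier_mat n n" using U by simp
  have dpos: "0 < d i" if i: "i < n" for i
  proof -
    have v: "col U i \<in> carrier_vec n" using U i by simp
    have "0 < Re ((S *\<^sub>v col U i) \<bullet>c col U i)"
      using pd S v unitary_col(2)[OF U UU(1) i] by (simp add: herm_pd_def)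
    also have "(S *\<^sub>v col U i) \<bullet>c col U i = complex_of_real (d i * (vnorm (col U i))\<^sup>2)"
      using v unfolding Seq unitary_col(3)[OF U UU(1) i] of_real_mult vnorm_sq by simp
    finally show ?thesis by (simp add: zero_less_mult_iff)
  qed
  let ?E = "mat_diag n (\<lambda>i. complex_of_real (sqrt (d i)))"
  have E: "?E \<in> carrier_mat n n" by simp
  define X where "X = U * ?E * mat_adjoint U"
  have X: "X \<in> carrier_mat n n" using U by (simp add: X_def mult_carrier_mat[of _ n n _ n])
  have "X * X = U * (?E * (mat_adjoint U * U) * ?E) * mat_adjoint U"
    using U U' E by (simp add: X_def assoc_mult_mat[of _ n n _ n _ n] mult_carrier_mat[of _ n n _ n] del: mat_diag_diag)
  also have "?E * (mat_adjoint U * U) * ?E = mat_diag n (\<lambda>i. complex_of_real (sqrt (d i) * sqrt (d i)))"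
    unfolding UU right_mult_one_mat[OF E] by (simp only: mat_diag_diag of_real_mult)
  also have "\<dots> = mat_diag n (\<lambda>i. complex_of_real (d i))"
    using dpos by (intro eq_matI) (auto simp: mat_diag_def real_sqrt_mult_self abs_of_pos simp flip: of_real_mult)
  finally have XX: "X * X = S" by (simp add: Seq)
  have "mat_adjoint X = X"
    using U U' E by (simp add: X_def mat_adjoint_mult[of _ n n _ n] mult_carrier_mat[of _ n n _ n]
        mat_adjoint_diag_real assoc_mult_mat[of _ n n _ n _ n])
  moreover have "0 < Re ((X *\<^sub>v x) \<bullet>c x)" if x: "x \<in> carrier_vec n" "x \<noteq> 0\<^sub>v n" for x
  proof -
    let ?y = "mat_adjoint U *\<^sub>v x"
    have "(\<Sum>i<n. (cmod (?y $ i))\<^sup>2) \<noteq> 0"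
      using unitary_vnorm[OF U UU(2) x(1)] vnorm_eq_0_iff[OF x(1)] x(2) by simp
    then obtain i where i: "i < n" "?y $ i \<noteq> 0"
      by (metis (mono_tags, lifting) lessThan_iff norm_zero power_zero_numeral sum.neutral)
    \<comment> \<open>All weights are positive, so the one nonzero coordinate makes the whole form
      positive.\<close>
    have "0 < (\<Sum>i<n. sqrt (d i) * (cmod (?y $ i))\<^sup>2)"
      using i dpos by (intro sum_pos2[of _ i]) (auto intro!: mult_pos_pos simp: less_imp_le)
    then show ?thesis unfolding X_def diag_quadratic_form[OF U x(1)] Re_complex_of_real .
  qed
  ultimately have "herm_pd X" using X by (auto simp: herm_pd_def)
  with X XX have ex: "X \<in> carrier_mat (dim_row S) (dim_row S) \<and> herm_pd X \<and> X * X = S"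
    using S by simp
  have "psd_sqrt S \<in> carrier_mat (dim_row S) (dim_row S) \<and> herm_pd (psd_sqrt S) \<and> psd_sqrt S * psd_sqrt S = S"
    unfolding psd_sqrt_def
    by (rule theI[of _ X]) (use ex hermitian_square_root_unique in blast)+
  then show "psd_sqrt S \<in> carrier_mat n n" "herm_pd (psd_sqrt S)" "psd_sqrt S * psd_sqrt S = S"
    using S by auto
qed

text \<open>Expand \<open>x\<close> in an orthonormal eigenbasis of
  \<open>mat_adjoint R * R\<close>. Orthogonality to the kernel of \<open>R\<close> removes the
  components with eigenvalue zero. Every other eigenvalue is the square of a positive singular
  value, hence at least the square of the smallest one.\<close>

lemma min_nonzero_singular_value_bound:
  assumes R: "R \<in> carrier_mat m n" and x: "x \<in> carrier_vec n" and x0: "x \<noteq> 0\<^sub>v n"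
    and orth: "\<And>y. y \<in> carrier_vec n \<Longrightarrow> R *\<^sub>v y = 0\<^sub>v m \<Longrightarrow> x \<bullet>c y = 0"
  shows "0 < min_nonzero_singular_value R"
    "(min_nonzero_singular_value R)\<^sup>2 * (vnorm x)\<^sup>2 \<le> (vnorm (R *\<^sub>v x))\<^sup>2"
proof -
  define H where "H = mat_adjoint R * R"
  have R': "mat_adjoint R \<in> carrier_mat n m" using R by simp
  have H: "H \<in> carrier_mat n n" using R by (simp add: H_def)
  have adjH: "mat_adjoint H = H" using R by (simp add: H_def mat_adjoint_mult[of _ n m _ n])
  have HR: "(H *\<^sub>v y) \<bullet>c y = complex_of_real ((vnorm (R *\<^sub>v y))\<^sup>2)" if y: "y \<in> carrier_vec n" for y
  proof -
    have Ry: "R *\<^sub>v y \<in> carrier_vec m" using R y by (rule mult_mat_vec_carrier)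
    have "(H *\<^sub>v y) \<bullet>c y = (mat_adjoint R *\<^sub>v (R *\<^sub>v y)) \<bullet>c y"
      using assoc_mult_mat_vec[OF R' R y] by (simp add: H_def)
    also have "\<dots> = (R *\<^sub>v y) \<bullet>c (R *\<^sub>v y)"
      using cscalar_prod_adjoint[OF R' Ry y] by simp
    finally show ?thesis by (simp only: vnorm_sq)
  qed
  obtain U d where U: "U \<in> carrier_mat n n" and UU: "mat_adjoint U * U = 1\<^sub>m n" "U * mat_adjoint U = 1\<^sub>m n"
    and Heq: "H = U * mat_diag n (\<lambda>i. complex_of_real (d i)) * mat_adjoint U"
    using hermitian_spectral[OF H adjH] by blast
  define u where "u = (\<lambda>i. col U i)"
  define y where "y = mat_adjoint U *\<^sub>v x"
  let ?P = "{s \<in> singular_values R. s > 0}"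
  have u: "u i \<in> carrier_vec n" and u0: "u i \<noteq> 0\<^sub>v n"
    and Hu: "H *\<^sub>v u i = complex_of_real (d i) \<cdot>\<^sub>v u i" if "i < n" for i
    using U that unitary_col[OF U UU(1) that] by (simp_all add: u_def Heq)
  have du: "d i * (vnorm (u i))\<^sup>2 = (vnorm (R *\<^sub>v u i))\<^sup>2" if "i < n" for i
  proof -
    have "complex_of_real (d i * (vnorm (u i))\<^sup>2) = complex_of_real ((vnorm (R *\<^sub>v u i))\<^sup>2)"
      using u[OF that] HR[OF u[OF that]] unfolding Hu[OF that] of_real_mult vnorm_sq by simp
    then show ?thesis by (simp only: of_real_eq_iff)
  qed
  have nu: "0 < (vnorm (u i))\<^sup>2" if "i < n" for i
    using vnorm_eq_0_iff[OF u[OF that]] u0[OF that] by simp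
  have d_nonneg: "0 \<le> d i" if "i < n" for i
    using du[OF that] nu[OF that] by (metis zero_le_mult_iff zero_le_power2 not_le)
  \<comment> \<open>An eigenvector with eigenvalue zero lies in the kernel of \<open>R\<close>, so
    \<open>x\<close> has no component along it.\<close>
  have y_zero: "y $ i = 0" if i: "i < n" and d0: "d i = 0" for i
  proof -
    have "R *\<^sub>v u i = 0\<^sub>v m"
      using du[OF i] vnorm_eq_0_iff[of "R *\<^sub>v u i" m] R u[OF i] by (simp add: d0 mult_mat_vec_carrier[of _ m n])
    then have "x \<bullet>c u i = 0" using orth u[OF i] by blast
    then show ?thesis
      using U x i by (simp add: y_def u_def scalar_prod_def mult.commute)
  qed
  have sv: "sqrt (d i) \<in> ?P" if i: "i < n" and "d i \<noteq> 0" for i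
  proof -
    have "0 < d i" using that d_nonneg[OF i] by simp
    moreover have "eigenvalue H (complex_of_real (d i))"
      using H u[OF i] u0[OF i] Hu[OF i] by (auto simp: eigenvalue_def eigenvector_def)
    ultimately show ?thesis by (simp add: singular_values_def H_def del: of_real_power)
  qed
  \<comment> \<open>\<open>Min\<close> is informative only on a finite nonempty set. Finiteness
    holds because a singular value is recovered from its square, which belongs to the finite
    spectrum of \<open>H\<close>.\<close>
  have "?P \<subseteq> (\<lambda>z. sqrt (Re z)) ` spectrum H"
  proof
    fix s assume "s \<in> ?P"
    then have "complex_of_real (s\<^sup>2) \<in> spectrum H" "s = sqrt (Re (complex_of_real (s\<^sup>2)))"
      by (simp_all add: singular_values_def spectrum_def H_def real_sqrt_abs del: of_real_power)
    then show "s \<in> (\<lambda>z. sqrt (Re z)) ` spectrum H" by blast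
  qed
  then have fin: "finite ?P"
    using card_finite_spectrum(1)[OF H] finite_surj by blast
  have normx: "(\<Sum>i<n. (cmod (y $ i))\<^sup>2) = (vnorm x)\<^sup>2"
    unfolding y_def by (rule unitary_vnorm[OF U UU(2) x])
  moreover have "(vnorm x)\<^sup>2 \<noteq> 0" using vnorm_eq_0_iff[OF x] x0 by simp
  ultimately obtain i where "i < n" "y $ i \<noteq> 0"
    by (metis (mono_tags, lifting) lessThan_iff norm_zero power_zero_numeral sum.neutral)
  \<comment> \<open>The nonzero coordinate of \<open>x\<close> belongs to a nonzero eigenvalue,
    whose root is a positive singular value.\<close>
  then have ne: "?P \<noteq> {}" using sv[of i] y_zero[of i] by blast
  let ?s = "min_nonzero_singular_value R"
  have "?s \<in> ?P" unfolding min_nonzero_singular_value_def using fin ne by (rule Min_in)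
  then show spos: "0 < ?s" by simp
  have "?s\<^sup>2 \<le> d i" if i: "i < n" and "d i \<noteq> 0" for i
  proof -
    have "?s \<le> sqrt (d i)"
      unfolding min_nonzero_singular_value_def using fin sv[OF that] by (rule Min_le)
    then have "?s\<^sup>2 \<le> (sqrt (d i))\<^sup>2" using spos by (intro power_mono) auto
    then show ?thesis using d_nonneg[OF i] by simp
  qed
  \<comment> \<open>Termwise: if \<open>d i = 0\<close>, both sides vanish by \<open>y_zero\<close>;
    otherwise the bound just shown applies.\<close>
  then have "(\<Sum>i<n. ?s\<^sup>2 * (cmod (y $ i))\<^sup>2) \<le> (\<Sum>i<n. d i * (cmod (y $ i))\<^sup>2)"
    using y_zero by (intro sum_mono) (metis lessThan_iff mult_right_mono norm_zero order_refl
        mult_zero_right power_zero_numeral zero_le_power2)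
  moreover have "(\<Sum>i<n. d i * (cmod (y $ i))\<^sup>2) = (vnorm (R *\<^sub>v x))\<^sup>2"
    using diag_quadratic_form[OF U x, of d] HR[OF x] unfolding Heq[symmetric] y_def
    by (simp only: of_real_eq_iff)
  ultimately show "?s\<^sup>2 * (vnorm x)\<^sup>2 \<le> (vnorm (R *\<^sub>v x))\<^sup>2"
    by (simp only: normx[symmetric] sum_distrib_left)
qed

section \<open>Block triangular systems\<close>

text \<open>An injective square matrix over a field has nonzero determinant, hence a two-sided
  inverse. Uniqueness of that inverse determines the definite description in
  \<open>minv\<close>.\<close>

lemma minv_props:
  assumes S: "S \<in> carrier_mat n n"
    and inj: "\<And>v. v \<in> carrier_vec n \<Longrightarrow> S *\<^sub>v v = 0\<^sub>v n \<Longrightarrow> v = 0\<^sub>v n"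
  shows "minv S \<in> carrier_mat n n" "S * minv S = 1\<^sub>m n" "minv S * S = 1\<^sub>m n"
proof -
  have "det S \<noteq> 0" using det_0_iff_vec_prod_zero_field[OF S] inj by blast
  from det_non_zero_imp_unit[OF S this, of "()"]
  obtain X where X: "X \<in> carrier_mat n n" "S * X = 1\<^sub>m n" "X * S = 1\<^sub>m n"
    by (auto simp: Units_def ring_mat_def)
  have uniq: "Y = X" if "Y \<in> carrier_mat n n" "S * Y = 1\<^sub>m n" "Y * S = 1\<^sub>m n" for Y
    using assoc_mult_mat[OF that(1) S X(1)] unfolding that(3) X(2)
    using left_mult_one_mat[OF X(1)] right_mult_one_mat[OF that(1)] by simp
  have dS: "dim_row S = n" using S by simp
  have "\<exists>!X. X \<in> carrier_mat n n \<and> S * X = 1\<^sub>m n \<and> X * S = 1\<^sub>m n"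
    using X uniq by blast
  from theI'[OF this] show "minv S \<in> carrier_mat n n" "S * minv S = 1\<^sub>m n" "minv S * S = 1\<^sub>m n"
    unfolding minv_def dS by auto
qed

text \<open>Lets \<open>minv\<close> be handled through linear systems, without a formula for the
  inverse.\<close>

lemma minv_mult_vec_eq_iff:
  assumes S: "S \<in> carrier_mat n n"
    and inj: "\<And>v. v \<in> carrier_vec n \<Longrightarrow> S *\<^sub>v v = 0\<^sub>v n \<Longrightarrow> v = 0\<^sub>v n"
    and v: "v \<in> carrier_vec n" and w: "w \<in> carrier_vec n"
  shows "minv S *\<^sub>v w = v \<longleftrightarrow> S *\<^sub>v v = w"
  using minv_props[OF S inj] assoc_mult_mat_vec[of S n n "minv S" n w]
    assoc_mult_mat_vec[of "minv S" n n S n v] S v w by auto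

lemma col_mat_adjoint:
  "j < dim_row A \<Longrightarrow> col (mat_adjoint A) j = conjugate (row A j)"
  by (intro eq_vecI) auto

lemma mat_adjoint_append_rows_mult_vec:
  fixes A B :: "complex mat"
  assumes A: "A \<in> carrier_mat m n" and B: "B \<in> carrier_mat k n"
    and v: "v \<in> carrier_vec m" and w: "w \<in> carrier_vec k"
  shows "mat_adjoint (A @\<^sub>r B) *\<^sub>v (v @\<^sub>v w) = mat_adjoint A *\<^sub>v v + mat_adjoint B *\<^sub>v w"
proof (rule eq_vecI)
  fix i assume "i < dim_vec (mat_adjoint A *\<^sub>v v + mat_adjoint B *\<^sub>v w)"
  then have i: "i < n" using B by simp
  have "row (mat_adjoint (A @\<^sub>r B)) i = row (mat_adjoint A) i @\<^sub>v row (mat_adjoint B) i"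
    using A B i by (intro eq_vecI) (auto simp: append_rows_def)
  then show "(mat_adjoint (A @\<^sub>r B) *\<^sub>v (v @\<^sub>v w)) $ i = (mat_adjoint A *\<^sub>v v + mat_adjoint B *\<^sub>v w) $ i"
    using A B v w i by (simp add: append_rows_def scalar_prod_append[of _ m _ k])
qed (use A B in \<open>simp add: append_rows_def\<close>)

text \<open>A diagonal block of \<open>D_mat\<close>, and at the same time the matrix inverted in
  one block step of the sweep.\<close>

definition gram_reg :: "real \<Rightarrow> complex mat \<Rightarrow> complex mat" where
  "gram_reg \<gamma> B = complex_of_real \<gamma> \<cdot>\<^sub>m 1\<^sub>m (dim_row B) + B * mat_adjoint B"

abbreviation num_rows :: "complex mat list \<Rightarrow> nat" where
  "num_rows As \<equiv> sum_list (map dim_row As)"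

text \<open>The block lower triangular matrix inverted by \<open>M_mat\<close>. Unlike the inverse,
  it is easily peeled block by block.\<close>

abbreviation T_mat :: "real \<Rightarrow> nat \<Rightarrow> complex mat list \<Rightarrow> complex mat" where
  "T_mat \<gamma> n As \<equiv> D_mat \<gamma> As + L_mat n As"

lemma gram_reg_carrier [simp]: "B \<in> carrier_mat m n \<Longrightarrow> gram_reg \<gamma> B \<in> carrier_mat m m"
  by (simp add: gram_reg_def mult_carrier_mat[of _ m n])

lemma gram_reg_mult_vec:
  assumes B: "B \<in> carrier_mat m n" and v: "v \<in> carrier_vec m"
  shows "gram_reg \<gamma> B *\<^sub>v v = complex_of_real \<gamma> \<cdot>\<^sub>v v + B *\<^sub>v (mat_adjoint B *\<^sub>v v)"
proof -
  have "gram_reg \<gamma> B *\<^sub>v v = (complex_of_real \<gamma> \<cdot>\<^sub>m 1\<^sub>m m) *\<^sub>v v + B * mat_adjoint B *\<^sub>v v"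
    using B v by (simp add: gram_reg_def add_mult_distrib_mat_vec[of _ m m] mult_carrier_mat[of _ m n])
  also have "(complex_of_real \<gamma> \<cdot>\<^sub>m 1\<^sub>m m) *\<^sub>v v = complex_of_real \<gamma> \<cdot>\<^sub>v v"
    using v by (intro eq_vecI) auto
  also have "B * mat_adjoint B *\<^sub>v v = B *\<^sub>v (mat_adjoint B *\<^sub>v v)"
    using B v by (simp add: assoc_mult_mat_vec[of _ m n _ m])
  finally show ?thesis .
qed

lemma gram_reg_quadratic_form:
  assumes B: "B \<in> carrier_mat m n" and v: "v \<in> carrier_vec m"
  shows "(gram_reg \<gamma> B *\<^sub>v v) \<bullet>c v = complex_of_real (\<gamma> * (vnorm v)\<^sup>2 + (vnorm (mat_adjoint B *\<^sub>v v))\<^sup>2)"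
proof -
  have Bv: "mat_adjoint B *\<^sub>v v \<in> carrier_vec n" using B v by (simp add: mult_mat_vec_carrier[of _ n m])
  then have "(gram_reg \<gamma> B *\<^sub>v v) \<bullet>c v = complex_of_real \<gamma> * (v \<bullet>c v) + (B *\<^sub>v (mat_adjoint B *\<^sub>v v)) \<bullet>c v"
    using B v by (simp add: gram_reg_mult_vec[OF B v] add_scalar_prod_distrib[of _ m] mult_mat_vec_carrier[of _ m n])
  then show ?thesis
    unfolding cscalar_prod_adjoint[OF B Bv v] of_real_add of_real_mult[of \<gamma>] vnorm_sq .
qed

section \<open>Block recursions for the stacked, diagonal and triangular matrices\<close>

lemma stack_mat_Cons: "stack_mat n (B # As) = B @\<^sub>r stack_mat n As"
  by (simp add: stack_mat_def)

lemma stack_mat_carrier: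
  assumes "\<forall>B \<in> set As. dim_col B = n"
  shows "stack_mat n As \<in> carrier_mat (num_rows As) n"
  using assms
proof (induction As)
  case (Cons B As)
  then obtain m where "B \<in> carrier_mat m n" "stack_mat n As \<in> carrier_mat (num_rows As) n"
    unfolding carrier_mat_def by auto
  then show ?case using carrier_append_rows[of B m n] by (auto simp: stack_mat_Cons)
qed (simp add: stack_mat_def)

lemma D_mat_carrier: "D_mat \<gamma> As \<in> carrier_mat (num_rows As) (num_rows As)"
  by (induction As) (auto simp: D_mat_def)

lemma D_mat_Cons:
  assumes "B \<in> carrier_mat m n"
  shows "D_mat \<gamma> (B # As) = four_block_mat (gram_reg \<gamma> B) (0\<^sub>m m (num_rows As))
     (0\<^sub>m (num_rows As) m) (D_mat \<gamma> As)"
  using D_mat_carrier[of \<gamma> As] assms by (auto simp: D_mat_def gram_reg_def)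

text \<open>Each nonempty prefix sum of \<open>r # rs\<close> is \<open>r\<close> plus a prefix sum
  of \<open>rs\<close>. Hence no block ends at or before a row index below \<open>r\<close>, and for
  any other index the first block is one more block that does.\<close>

lemma blk_Cons: "blk (r # rs) a = (if a < r then 0 else Suc (blk rs (a - r)))"
proof -
  have *: "{j. j < length (r # rs) \<and> sum_list (take (Suc j) (r # rs)) \<le> a}
    = (if a < r then {} else insert 0 (Suc ` {j. j < length rs \<and> sum_list (take (Suc j) rs) \<le> a - r}))"
    (is "?L = ?R")
  proof (rule Set.set_eqI)
    fix j show "j \<in> ?L \<longleftrightarrow> j \<in> ?R"
      by (cases j) (auto simp: image_iff)
  qed
  show ?thesis unfolding blk_def * by (simp add: card_insert_if card_image)
qed

lemma L_mat_carrier: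
  assumes "\<forall>B \<in> set As. dim_col B = n"
  shows "L_mat n As \<in> carrier_mat (num_rows As) (num_rows As)"
  using stack_mat_carrier[OF assms] by (simp add: L_mat_def Let_def)

text \<open>Rows of the first block have block index 0, so nothing lies strictly to their left. The
  later rows keep all Gram entries in the columns of the first block; in the remaining columns both
  block indices drop by one, which leaves their comparison unchanged.\<close>

lemma L_mat_Cons:
  assumes Bc: "B \<in> carrier_mat m n" and As: "\<forall>B \<in> set As. dim_col B = n"
  shows "L_mat n (B # As) = four_block_mat (0\<^sub>m m m) (0\<^sub>m m (num_rows As))
     (stack_mat n As * mat_adjoint B) (L_mat n As)"
    (is "_ = ?R")
proof (rule eq_matI)
  let ?A = "stack_mat n As" let ?N = "num_rows As"
  have A: "?A \<in> carrier_mat ?N n" using As by (rule stack_mat_carrier)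
  have dB: "dim_row B = m" using Bc by simp
  have BA: "B @\<^sub>r ?A \<in> carrier_mat (m + ?N) n" using Bc A by (rule carrier_append_rows)
  have L: "L_mat n As \<in> carrier_mat ?N ?N" using As by (rule L_mat_carrier)
  have dims: "dim_row (B @\<^sub>r ?A) = m + ?N" "dim_row ?A = ?N" "dim_col ?A = n" using BA A by auto
  show "dim_row (L_mat n (B # As)) = dim_row ?R" "dim_col (L_mat n (B # As)) = dim_col ?R"
    using dims L by (simp_all add: L_mat_def Let_def stack_mat_Cons dB)
  fix i j assume "i < dim_row ?R" "j < dim_col ?R"
  then have ij: "i < m + ?N" "j < m + ?N" using L by auto
  have row: "row (B @\<^sub>r ?A) i = (if i < m then row B i else row ?A (i - m))" if "i < m + ?N" for i
    using that A Bc by (intro eq_vecI) (auto simp: append_rows_def)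
  have "((B @\<^sub>r ?A) * mat_adjoint (B @\<^sub>r ?A)) $$ (i, j)
      = row (B @\<^sub>r ?A) i \<bullet> conjugate (row (B @\<^sub>r ?A) j)"
    using ij dims by (simp add: col_mat_adjoint)
  then have L_ij: "L_mat n (B # As) $$ (i, j) =
      (if blk (m # map dim_row As) j < blk (m # map dim_row As) i
       then row (B @\<^sub>r ?A) i \<bullet> conjugate (row (B @\<^sub>r ?A) j) else 0)"
    using ij dims by (simp add: L_mat_def Let_def stack_mat_Cons dB)
  show "L_mat n (B # As) $$ (i, j) = ?R $$ (i, j)"
  \<comment> \<open>The cases are the zero top block row, the Gram block of the later rows against
    \<open>B\<close>, and the recursive block.\<close>
  proof (cases "i < m")
    case True
    then have "L_mat n (B # As) $$ (i, j) = 0" unfolding L_ij blk_Cons by simp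
    then show ?thesis using True ij L by simp
  next
    case i: False
    define i' where "i' = i - m"
    have i': "i' < ?N" using i ij by (simp add: i'_def)
    show ?thesis
    proof (cases "j < m")
      case True
      then have "L_mat n (B # As) $$ (i, j) = row ?A i' \<bullet> conjugate (row B j)"
        using i ij dB unfolding L_ij blk_Cons by (simp add: row i'_def)
      also have "\<dots> = (?A * mat_adjoint B) $$ (i', j)"
        using i' True dims dB by (simp add: col_mat_adjoint)
      finally show ?thesis using True i ij L dims dB by (simp add: i'_def)
    next
      case j: False
      define j' where "j' = j - m"
      have j': "j' < ?N" using j ij by (simp add: j'_def)
      have "L_mat n (B # As) $$ (i, j) =
          (if blk (map dim_row As) j' < blk (map dim_row As) i' then row ?A i' \<bullet> conjugate (row ?A j') else 0)"
        using i j ij dB unfolding L_ij blk_Cons by (simp add: row i'_def j'_def)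
      also have "\<dots> = L_mat n As $$ (i', j')"
        using i' j' dims by (simp add: L_mat_def Let_def col_mat_adjoint)
      finally show ?thesis using i j ij L dims by (simp add: i'_def j'_def)
    qed
  qed
qed

lemma T_mat_carrier:
  assumes "\<forall>B \<in> set As. dim_col B = n"
  shows "T_mat \<gamma> n As \<in> carrier_mat (num_rows As) (num_rows As)"
  using L_mat_carrier[OF assms] D_mat_carrier by simp

text \<open>The recursion behind forward substitution: \<open>D_mat\<close> contributes the diagonal
  blocks, \<open>L_mat\<close> the coupling of the first block to the later ones.\<close>

lemma T_mat_Cons:
  assumes B: "B \<in> carrier_mat m n" and As: "\<forall>B \<in> set As. dim_col B = n"
  shows "T_mat \<gamma> n (B # As) = four_block_mat (gram_reg \<gamma> B) (0\<^sub>m m (num_rows As))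
     (stack_mat n As * mat_adjoint B) (T_mat \<gamma> n As)"
proof -
  have AB: "stack_mat n As * mat_adjoint B \<in> carrier_mat (num_rows As) m"
    using stack_mat_carrier[OF As] B by (simp add: mult_carrier_mat[of _ _ n])
  show ?thesis
    unfolding D_mat_Cons[OF B] L_mat_Cons[OF assms]
    using add_four_block_mat[OF gram_reg_carrier[OF B] zero_carrier_mat zero_carrier_mat D_mat_carrier
        zero_carrier_mat zero_carrier_mat AB L_mat_carrier[OF As]] gram_reg_carrier[OF B] AB
    by simp
qed

section \<open>Auxiliary identities for vectors and norms\<close>

lemma zero_mat_mult_vec:
  "v \<in> carrier_vec n \<Longrightarrow> 0\<^sub>m m n *\<^sub>v v = (0\<^sub>v m :: 'a :: semiring_0 vec)"
  by (intro eq_vecI) auto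

lemma mat_mult_zero_vec:
  "A \<in> carrier_mat m n \<Longrightarrow> A *\<^sub>v 0\<^sub>v n = (0\<^sub>v m :: 'a :: semiring_0 vec)"
  by (intro eq_vecI) auto

lemma minus_minus_minus_vec:
  fixes a b c d :: "'a :: ab_group_add vec"
  assumes "a \<in> carrier_vec n" "b \<in> carrier_vec n" "c \<in> carrier_vec n" "d \<in> carrier_vec n"
  shows "(a - b) - (c - d) = (a - c) - (b - d)"
  using assms by (intro eq_vecI) auto

lemma conjugate_append_vec:
  "conjugate (v @\<^sub>v w) = conjugate v @\<^sub>v conjugate w"
  by (rule eq_vecI) auto

lemma minus_append_vec:
  assumes "v \<in> carrier_vec m" "v' \<in> carrier_vec m" "w \<in> carrier_vec n" "w' \<in> carrier_vec n"
  shows "(v @\<^sub>v w) - (v' @\<^sub>v w') = (v - v') @\<^sub>v (w - w')"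
  using assms by (intro eq_vecI) auto

lemma cscalar_prod_append:
  fixes v v' :: "complex vec"
  assumes "v \<in> carrier_vec m" "v' \<in> carrier_vec m" "w \<in> carrier_vec n" "w' \<in> carrier_vec n"
  shows "(v @\<^sub>v w) \<bullet>c (v' @\<^sub>v w') = v \<bullet>c v' + w \<bullet>c w'"
  unfolding conjugate_append_vec using assms by (intro scalar_prod_append) auto

lemma vnorm_append_sq:
  assumes "v \<in> carrier_vec m" "w \<in> carrier_vec n"
  shows "(vnorm (v @\<^sub>v w))\<^sup>2 = (vnorm v)\<^sup>2 + (vnorm w)\<^sup>2"
  using cscalar_prod_append[OF assms(1,1) assms(2,2)] by (simp add: vnorm_sq_Re)

lemma vnorm_add_sq:
  assumes v: "v \<in> carrier_vec n" and w: "w \<in> carrier_vec n"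
  shows "(vnorm (v + w))\<^sup>2 = (vnorm v)\<^sup>2 + 2 * Re (v \<bullet>c w) + (vnorm w)\<^sup>2"
proof -
  have "Re ((v + w) \<bullet>c (v + w)) = Re (v \<bullet>c v) + Re (v \<bullet>c w) + (Re (w \<bullet>c v) + Re (w \<bullet>c w))"
    using v w by (simp add: conjugate_add_vec[of _ n] add_scalar_prod_distrib[of _ n] scalar_prod_add_distrib[of _ n])
  also have "Re (w \<bullet>c v) = Re (v \<bullet>c w)"
    using cscalar_prod_commute[OF v w] by simp
  finally show ?thesis by (simp add: vnorm_sq_Re)
qed

lemma vnorm_minus_sq:
  assumes v: "v \<in> carrier_vec n" and w: "w \<in> carrier_vec n"
  shows "(vnorm (v - w))\<^sup>2 = (vnorm v)\<^sup>2 - 2 * Re (v \<bullet>c w) + (vnorm w)\<^sup>2"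
proof -
  have "v - w = v + (- 1) \<cdot>\<^sub>v w" using v w by (intro eq_vecI) auto
  moreover have "v \<bullet>c ((- 1) \<cdot>\<^sub>v w) = - (v \<bullet>c w)" "vnorm ((- 1) \<cdot>\<^sub>v w) = vnorm w"
    using v w by (simp_all add: conjugate_smult_vec vnorm_def)
  ultimately show ?thesis using vnorm_add_sq[OF v, of "(- 1) \<cdot>\<^sub>v w"] w by simp
qed

section \<open>Symmetry, quadratic forms and definiteness of the block matrices\<close>

lemma gram_reg_adjoint:
  assumes B: "B \<in> carrier_mat m n"
  shows "mat_adjoint (gram_reg \<gamma> B) = gram_reg \<gamma> B"
proof (rule eq_matI)
  fix i j assume "i < dim_row (gram_reg \<gamma> B)" "j < dim_col (gram_reg \<gamma> B)"
  then show "mat_adjoint (gram_reg \<gamma> B) $$ (i, j) = gram_reg \<gamma> B $$ (i, j)"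
    using B by (auto simp: gram_reg_def col_mat_adjoint scalar_prod_def mult.commute)
qed (simp_all add: gram_reg_def)

lemma D_mat_adjoint:
  assumes "\<forall>B \<in> set As. dim_col B = n"
  shows "mat_adjoint (D_mat \<gamma> As) = D_mat \<gamma> As"
  using assms
proof (induction As)
  case Nil
  show ?case by (rule eq_matI) (auto simp: D_mat_def)
next
  case (Cons B As)
  obtain m where B: "B \<in> carrier_mat m n" using Cons.prems by (metis carrier_matI list.set_intros(1))
  show ?case
    unfolding D_mat_Cons[OF B] mat_adjoint_four_block_diag[OF gram_reg_carrier[OF B] D_mat_carrier]
      gram_reg_adjoint[OF B] using Cons by simp
qed

lemma D_mat_Cons_quadratic_form:
  assumes B: "B \<in> carrier_mat m n" and v: "v \<in> carrier_vec m" and w: "w \<in> carrier_vec (num_rows As)"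
  shows "(D_mat \<gamma> (B # As) *\<^sub>v (v @\<^sub>v w)) \<bullet>c (v @\<^sub>v w)
       = (gram_reg \<gamma> B *\<^sub>v v) \<bullet>c v + (D_mat \<gamma> As *\<^sub>v w) \<bullet>c w"
proof -
  have "D_mat \<gamma> (B # As) *\<^sub>v (v @\<^sub>v w) = (gram_reg \<gamma> B *\<^sub>v v) @\<^sub>v (D_mat \<gamma> As *\<^sub>v w)"
    unfolding D_mat_Cons[OF B]
      four_block_mat_mult_vec[OF gram_reg_carrier[OF B] zero_carrier_mat zero_carrier_mat D_mat_carrier v w]
    using mult_mat_vec_carrier[OF gram_reg_carrier[OF B] v, of \<gamma>] mult_mat_vec_carrier[OF D_mat_carrier w, of \<gamma>]
    by (simp add: zero_mat_mult_vec[OF v] zero_mat_mult_vec[OF w])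
  then show ?thesis
    using cscalar_prod_append[OF mult_mat_vec_carrier[OF gram_reg_carrier[OF B] v] v
        mult_mat_vec_carrier[OF D_mat_carrier w] w] by simp
qed

text \<open>One stage of forward substitution: the first component involves \<open>v\<close> alone,
  and \<open>v\<close> enters the others only through
  \<open>mat_adjoint B *\<^sub>v v\<close>.\<close>

lemma T_mat_Cons_mult_vec:
  assumes B: "B \<in> carrier_mat m n" and As: "\<forall>B \<in> set As. dim_col B = n"
    and v: "v \<in> carrier_vec m" and w: "w \<in> carrier_vec (num_rows As)"
  shows "T_mat \<gamma> n (B # As) *\<^sub>v (v @\<^sub>v w)
    = (gram_reg \<gamma> B *\<^sub>v v) @\<^sub>v (stack_mat n As *\<^sub>v (mat_adjoint B *\<^sub>v v) + T_mat \<gamma> n As *\<^sub>v w)"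
proof -
  have A: "stack_mat n As \<in> carrier_mat (num_rows As) n" using As by (rule stack_mat_carrier)
  have B': "mat_adjoint B \<in> carrier_mat n m" using B by simp
  show ?thesis
    unfolding T_mat_Cons[OF B As]
      four_block_mat_mult_vec[OF gram_reg_carrier[OF B] zero_carrier_mat mult_carrier_mat[OF A B']
        T_mat_carrier[OF As] v w] assoc_mult_mat_vec[OF A B' v]
    using mult_mat_vec_carrier[OF gram_reg_carrier[OF B] v, of \<gamma>] by (simp add: zero_mat_mult_vec[OF w])
qed

lemma append_vec_split:
  fixes v :: "'a vec"
  assumes "v \<in> carrier_vec (m + n)"
  obtains v1 v2 where "v1 \<in> carrier_vec m" "v2 \<in> carrier_vec n" "v = v1 @\<^sub>v v2"
  using vec_first_last_append[OF assms] vec_first_carrier vec_last_carrier by metis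

text \<open>Each block contributes \<open>\<gamma>\<close> times the squared norm of its component
  plus the square of a norm; the latter is dropped.\<close>

lemma D_mat_coercive:
  assumes "\<forall>B \<in> set As. dim_col B = n" "v \<in> carrier_vec (num_rows As)"
  shows "\<gamma> * (vnorm v)\<^sup>2 \<le> Re ((D_mat \<gamma> As *\<^sub>v v) \<bullet>c v)"
  using assms
proof (induction As arbitrary: v)
  case Nil
  then show ?case by (simp add: vnorm_def scalar_prod_def)
next
  case (Cons B As)
  obtain m where B: "B \<in> carrier_mat m n" using Cons.prems by (metis carrier_matI list.set_intros(1))
  with Cons.prems have "v \<in> carrier_vec (m + num_rows As)" by simp
  then obtain v1 v2 where v1: "v1 \<in> carrier_vec m" and v2: "v2 \<in> carrier_vec (num_rows As)"
    and v: "v = v1 @\<^sub>v v2" by (rule append_vec_split)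
  have "\<gamma> * (vnorm v2)\<^sup>2 \<le> Re ((D_mat \<gamma> As *\<^sub>v v2) \<bullet>c v2)" using Cons v2 by simp
  then show ?case
    unfolding v D_mat_Cons_quadratic_form[OF B v1 v2] gram_reg_quadratic_form[OF B v1]
      vnorm_append_sq[OF v1 v2]
    by (simp add: algebra_simps add_increasing2 del: of_real_power)
qed

text \<open>The identity \<open>T + T\<^sup>* = D + A A\<^sup>*\<close>, with \<open>D\<close> taken
  at \<open>2 * \<gamma>\<close>, as a statement on quadratic forms. In the induction each diagonal
  block gives \<open>b \<bullet>c b\<close> twice: one copy goes into \<open>D\<close>, the other
  joins the cross term \<open>2 * Re (b \<bullet>c a)\<close> and the square of \<open>a\<close> to
  form the square of \<open>b + a\<close>.\<close>

lemma T_mat_quadratic_form: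
  assumes "\<forall>B \<in> set As. dim_col B = n" "v \<in> carrier_vec (num_rows As)"
  shows "2 * Re ((T_mat \<gamma> n As *\<^sub>v v) \<bullet>c v)
       = Re ((D_mat (2 * \<gamma>) As *\<^sub>v v) \<bullet>c v) + (vnorm (mat_adjoint (stack_mat n As) *\<^sub>v v))\<^sup>2"
  using assms
proof (induction As arbitrary: v)
  case Nil
  then show ?case by (simp add: vnorm_def scalar_prod_def stack_mat_def)
next
  case (Cons B As)
  obtain m where B: "B \<in> carrier_mat m n" using Cons.prems by (metis carrier_matI list.set_intros(1))
  have As: "\<forall>B \<in> set As. dim_col B = n" using Cons.prems by simp
  from B Cons.prems have "v \<in> carrier_vec (m + num_rows As)" by simp
  then obtain v1 v2 where v1: "v1 \<in> carrier_vec m" and v2: "v2 \<in> carrier_vec (num_rows As)"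
    and v: "v = v1 @\<^sub>v v2" by (rule append_vec_split)
  let ?A = "stack_mat n As"
  have A: "?A \<in> carrier_mat (num_rows As) n" using As by (rule stack_mat_carrier)
  define b where "b = mat_adjoint B *\<^sub>v v1"
  define a where "a = mat_adjoint ?A *\<^sub>v v2"
  have a: "a \<in> carrier_vec n" and b: "b \<in> carrier_vec n"
    using A B v1 v2 by (simp_all add: a_def b_def mult_mat_vec_carrier[of _ n m] mult_mat_vec_carrier[of _ n "num_rows As"])
  have Ab: "?A *\<^sub>v b \<in> carrier_vec (num_rows As)" using A b by (rule mult_mat_vec_carrier)
  have Tv: "T_mat \<gamma> n As *\<^sub>v v2 \<in> carrier_vec (num_rows As)"
    using T_mat_carrier[OF As] v2 by (rule mult_mat_vec_carrier)
  have "(T_mat \<gamma> n (B # As) *\<^sub>v v) \<bullet>c v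
      = (gram_reg \<gamma> B *\<^sub>v v1) \<bullet>c v1 + ((?A *\<^sub>v b) \<bullet>c v2 + (T_mat \<gamma> n As *\<^sub>v v2) \<bullet>c v2)"
    unfolding v T_mat_Cons_mult_vec[OF B As v1 v2] b_def[symmetric]
      cscalar_prod_append[OF mult_mat_vec_carrier[OF gram_reg_carrier[OF B] v1] v1 add_carrier_vec[OF Ab Tv] v2]
    using add_scalar_prod_distrib[OF Ab Tv, of "conjugate v2"] v2 by simp
  moreover have "(?A *\<^sub>v b) \<bullet>c v2 = b \<bullet>c a"
    unfolding a_def by (rule cscalar_prod_adjoint[OF A b v2])
  moreover have "mat_adjoint (stack_mat n (B # As)) *\<^sub>v v = b + a"
    unfolding stack_mat_Cons v a_def b_def by (rule mat_adjoint_append_rows_mult_vec[OF B A v1 v2])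
  moreover note Cons.IH[OF As v2]
  ultimately show ?case
    using vnorm_add_sq[OF b a]
    unfolding v D_mat_Cons_quadratic_form[OF B v1 v2] gram_reg_quadratic_form[OF B v1] a_def[symmetric] b_def[symmetric]
    by (simp add: algebra_simps del: of_real_power)
qed

text \<open>The real part of the quadratic form is at least
  \<open>\<gamma> * (vnorm v)\<^sup>2\<close>, so the kernel is trivial. This makes
  \<open>M_mat\<close> a genuine inverse.\<close>

lemma T_mat_inj:
  assumes As: "\<forall>B \<in> set As. dim_col B = n" and \<gamma>: "0 < \<gamma>"
    and v: "v \<in> carrier_vec (num_rows As)" and 0: "T_mat \<gamma> n As *\<^sub>v v = 0\<^sub>v (num_rows As)"
  shows "v = 0\<^sub>v (num_rows As)"
proof -
  have "2 * \<gamma> * (vnorm v)\<^sup>2 \<le> Re ((D_mat (2 * \<gamma>) As *\<^sub>v v) \<bullet>c v)"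
    by (rule D_mat_coercive[OF As v])
  also have "\<dots> \<le> 2 * Re ((T_mat \<gamma> n As *\<^sub>v v) \<bullet>c v)"
    unfolding T_mat_quadratic_form[OF As v] by simp
  also have "\<dots> = 0" unfolding 0 using v by simp
  finally have "vnorm v = 0" using \<gamma> by (simp add: mult_le_0_iff)
  then show ?thesis using vnorm_eq_0_iff[OF v] by simp
qed

lemma gram_reg_inj:
  assumes B: "B \<in> carrier_mat m n" and \<gamma>: "0 < \<gamma>"
    and v: "v \<in> carrier_vec m" and 0: "gram_reg \<gamma> B *\<^sub>v v = 0\<^sub>v m"
  shows "v = 0\<^sub>v m"
proof -
  have "complex_of_real (\<gamma> * (vnorm v)\<^sup>2 + (vnorm (mat_adjoint B *\<^sub>v v))\<^sup>2) = 0"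
    unfolding gram_reg_quadratic_form[OF B v, symmetric] 0 using v by simp
  then have "\<gamma> * (vnorm v)\<^sup>2 + (vnorm (mat_adjoint B *\<^sub>v v))\<^sup>2 = 0"
    by (simp only: of_real_eq_0_iff)
  moreover have "0 \<le> (vnorm (mat_adjoint B *\<^sub>v v))\<^sup>2" "0 \<le> \<gamma> * (vnorm v)\<^sup>2" using \<gamma> by simp_all
  ultimately have "\<gamma> * (vnorm v)\<^sup>2 = 0" by linarith
  then show ?thesis using vnorm_eq_0_iff[OF v] \<gamma> by simp
qed

text \<open>Coercivity gives definiteness; the root occurring in \<open>R_mat\<close> is thereby
  well defined.\<close>

lemma D_mat_herm_pd:
  assumes As: "\<forall>B \<in> set As. dim_col B = n" and \<gamma>: "0 < \<gamma>"
  shows "herm_pd (D_mat \<gamma> As)"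
proof -
  have D: "D_mat \<gamma> As \<in> carrier_mat (num_rows As) (num_rows As)" by (rule D_mat_carrier)
  have "0 < Re ((D_mat \<gamma> As *\<^sub>v v) \<bullet>c v)" if v: "v \<in> carrier_vec (num_rows As)" "v \<noteq> 0\<^sub>v (num_rows As)" for v
  proof -
    have "0 < \<gamma> * (vnorm v)\<^sup>2" using \<gamma> vnorm_eq_0_iff[OF v(1)] v(2) by simp
    then show ?thesis using D_mat_coercive[OF As v(1), of \<gamma>] by linarith
  qed
  then show ?thesis using D D_mat_adjoint[OF As] by (auto simp: herm_pd_def)
qed

section \<open>The sweep as forward substitution\<close>

lemma stack_vec_Cons: "stack_vec (p # ps) = p @\<^sub>v stack_vec ps"
  by (simp add: stack_vec_def)

lemma stack_vec_carrier:
  assumes "list_all2 (\<lambda>B p. p \<in> carrier_vec (dim_row B)) As ps"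
  shows "stack_vec ps \<in> carrier_vec (num_rows As)"
  using assms by induction (auto simp: stack_vec_Cons, simp add: stack_vec_def)

lemma kaczmarz_sweep_Cons:
  "kaczmarz_sweep \<gamma> (B # As) (p # ps) q
   = kaczmarz_sweep \<gamma> As ps (q + mat_adjoint B *\<^sub>v (minv (gram_reg \<gamma> B) *\<^sub>v (p - B *\<^sub>v q)))"
  by (simp add: kaczmarz_sweep_def gram_reg_def)

text \<open>Induction over the blocks, for all starting points, since the remaining blocks start
  from the already corrected vector. The solution is given existentially through
  \<open>T_mat\<close> rather than through \<open>M_mat\<close>, so that no block inverse has to be
  computed.\<close>

lemma kaczmarz_sweep_eq:
  assumes "list_all2 (\<lambda>B p. p \<in> carrier_vec (dim_row B)) As ps"
    and "\<forall>B \<in> set As. dim_col B = n" and \<gamma>: "0 < \<gamma>" and "q \<in> carrier_vec n"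
  shows "\<exists>y \<in> carrier_vec (num_rows As). T_mat \<gamma> n As *\<^sub>v y = stack_vec ps - stack_mat n As *\<^sub>v q
          \<and> kaczmarz_sweep \<gamma> As ps q = q + mat_adjoint (stack_mat n As) *\<^sub>v y"
  using assms(1,2,4)
proof (induction arbitrary: q)
  case Nil
  have "dim_row (L_mat n []) = 0" using L_mat_carrier[of "[]" n] by simp
  then have "T_mat \<gamma> n [] *\<^sub>v 0\<^sub>v 0 = stack_vec [] - stack_mat n [] *\<^sub>v q"
    by (intro eq_vecI) (auto simp: stack_vec_def stack_mat_def)
  moreover have "kaczmarz_sweep \<gamma> [] [] q = q + mat_adjoint (stack_mat n []) *\<^sub>v 0\<^sub>v 0"
    using Nil by (intro eq_vecI) (auto simp: kaczmarz_sweep_def stack_mat_def)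
  ultimately show ?case by (intro bexI[of _ "0\<^sub>v 0"]) auto
next
  case (Cons B As p ps)
  obtain m where B: "B \<in> carrier_mat m n" using Cons.prems by (metis carrier_matI list.set_intros(1))
  have p: "p \<in> carrier_vec m" using Cons.hyps B by simp
  have As: "\<forall>B \<in> set As. dim_col B = n" using Cons.prems by simp
  note q = Cons.prems(2)
  let ?A = "stack_mat n As"
  let ?N = "num_rows As"
  have A: "?A \<in> carrier_mat ?N n" using As by (rule stack_mat_carrier)
  have B': "mat_adjoint B \<in> carrier_mat n m" using B by simp
  have Bq: "B *\<^sub>v q \<in> carrier_vec m" using B q by (rule mult_mat_vec_carrier)
  have Aq: "?A *\<^sub>v q \<in> carrier_vec ?N" using A q by (rule mult_mat_vec_carrier)
  \<comment> \<open>The first block of the solution; \<open>b\<close> below is the correction that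
    it causes in the first block step.\<close>
  define y1 where "y1 = minv (gram_reg \<gamma> B) *\<^sub>v (p - B *\<^sub>v q)"
  note G = gram_reg_carrier[OF B, of \<gamma>]
  note Ginj = gram_reg_inj[OF B \<gamma>]
  have y1: "y1 \<in> carrier_vec m"
    using minv_props(1)[OF G Ginj] p Bq unfolding y1_def by (intro mult_mat_vec_carrier) auto
  have Gy1: "gram_reg \<gamma> B *\<^sub>v y1 = p - B *\<^sub>v q"
    using minv_mult_vec_eq_iff[OF G Ginj y1, of "p - B *\<^sub>v q"] p Bq by (simp add: y1_def)
  define b where "b = mat_adjoint B *\<^sub>v y1"
  have b: "b \<in> carrier_vec n" using B' y1 unfolding b_def by (rule mult_mat_vec_carrier)
  have Ab: "?A *\<^sub>v b \<in> carrier_vec ?N" using A b by (rule mult_mat_vec_carrier)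
  have qb: "q + b \<in> carrier_vec n" using q b by simp
  obtain y2 where y2: "y2 \<in> carrier_vec ?N"
    and Ty2: "T_mat \<gamma> n As *\<^sub>v y2 = stack_vec ps - ?A *\<^sub>v (q + b)"
    and sweep: "kaczmarz_sweep \<gamma> As ps (q + b) = q + b + mat_adjoint ?A *\<^sub>v y2"
    using Cons.IH[OF As qb] by blast
  have s: "stack_vec ps \<in> carrier_vec ?N" by (rule stack_vec_carrier[OF Cons.hyps(2)])
  have Ay2: "mat_adjoint ?A *\<^sub>v y2 \<in> carrier_vec n"
    using A y2 by (intro mult_mat_vec_carrier[of _ n ?N]) auto
  \<comment> \<open>The remaining blocks see \<open>q + b\<close>. Bringing the image of
    \<open>b\<close> to the left gives exactly the lower block row of the full triangular
    system.\<close>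
  have "?A *\<^sub>v b + T_mat \<gamma> n As *\<^sub>v y2 = stack_vec ps - ?A *\<^sub>v q"
    unfolding Ty2 mult_add_distrib_mat_vec[OF A q b]
    using Ab Aq s by (intro eq_vecI) auto
  then have "T_mat \<gamma> n (B # As) *\<^sub>v (y1 @\<^sub>v y2) = (p - B *\<^sub>v q) @\<^sub>v (stack_vec ps - ?A *\<^sub>v q)"
    unfolding T_mat_Cons_mult_vec[OF B As y1 y2] Gy1 b_def by simp
  also have "\<dots> = stack_vec (p # ps) - stack_mat n (B # As) *\<^sub>v q"
    unfolding stack_vec_Cons stack_mat_Cons mat_mult_append[OF B A q]
    by (rule minus_append_vec[OF p Bq s Aq, symmetric])
  finally have "T_mat \<gamma> n (B # As) *\<^sub>v (y1 @\<^sub>v y2) = stack_vec (p # ps) - stack_mat n (B # As) *\<^sub>v q" .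
  moreover have "kaczmarz_sweep \<gamma> (B # As) (p # ps) q = q + mat_adjoint (stack_mat n (B # As)) *\<^sub>v (y1 @\<^sub>v y2)"
    unfolding kaczmarz_sweep_Cons y1_def[symmetric] b_def[symmetric] sweep stack_mat_Cons
      mat_adjoint_append_rows_mult_vec[OF B A y1 y2]
    using assoc_add_vec[OF q b Ay2] by simp
  moreover have "y1 @\<^sub>v y2 \<in> carrier_vec (num_rows (B # As))" using y1 y2 B by auto
  ultimately show ?case by blast
qed

section \<open>Error propagation\<close>

lemma M_mat_props:
  assumes As: "\<forall>B \<in> set As. dim_col B = n" and \<gamma>: "0 < \<gamma>"
  shows "M_mat \<gamma> n As \<in> carrier_mat (num_rows As) (num_rows As)"
    and "v \<in> carrier_vec (num_rows As) \<Longrightarrow> w \<in> carrier_vec (num_rows As) \<Longrightarrow>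
      M_mat \<gamma> n As *\<^sub>v w = v \<longleftrightarrow> T_mat \<gamma> n As *\<^sub>v v = w"
  using minv_props(1)[OF T_mat_carrier[OF As] T_mat_inj[OF As \<gamma>]]
    minv_mult_vec_eq_iff[OF T_mat_carrier[OF As] T_mat_inj[OF As \<gamma>]]
  by (auto simp: M_mat_def)

text \<open>Subtracting the triangular systems of the two sweeps shows that \<open>M\<close> maps
  \<open>d - A *\<^sub>v e\<close>, with \<open>d\<close> the difference of the data, to the
  difference of their solutions. The first summand of the result is \<open>B_mat\<close> applied to
  \<open>e\<close>, written through matrix-vector products.\<close>

lemma kaczmarz_sweep_diff:
  assumes ps: "list_all2 (\<lambda>B p. p \<in> carrier_vec (dim_row B)) As ps"
    and pts: "list_all2 (\<lambda>B p. p \<in> carrier_vec (dim_row B)) As pts"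
    and As: "\<forall>B \<in> set As. dim_col B = n" and \<gamma>: "0 < \<gamma>"
    and q: "q \<in> carrier_vec n" and q': "q' \<in> carrier_vec n"
  defines "A \<equiv> stack_mat n As" and "M \<equiv> M_mat \<gamma> n As" and "e \<equiv> q' - q"
  shows "kaczmarz_sweep \<gamma> As pts q' - kaczmarz_sweep \<gamma> As ps q
       = (e - mat_adjoint A *\<^sub>v (M *\<^sub>v (A *\<^sub>v e))) + mat_adjoint A *\<^sub>v (M *\<^sub>v (stack_vec pts - stack_vec ps))"
proof -
  let ?N = "num_rows As"
  have A: "A \<in> carrier_mat ?N n" unfolding A_def using As by (rule stack_mat_carrier)
  have A': "mat_adjoint A \<in> carrier_mat n ?N" using A by simp
  have M: "M \<in> carrier_mat ?N ?N" unfolding M_def using M_mat_props(1)[OF As \<gamma>] .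
  have T: "T_mat \<gamma> n As \<in> carrier_mat ?N ?N" using As by (rule T_mat_carrier)
  have e: "e \<in> carrier_vec n" using q q' by (simp add: e_def)
  have s: "stack_vec ps \<in> carrier_vec ?N" "stack_vec pts \<in> carrier_vec ?N"
    using ps pts by (auto intro: stack_vec_carrier)
  define d where "d = stack_vec pts - stack_vec ps"
  have d: "d \<in> carrier_vec ?N" using s by (simp add: d_def)
  obtain y where y: "y \<in> carrier_vec ?N" "T_mat \<gamma> n As *\<^sub>v y = stack_vec ps - A *\<^sub>v q"
    and sw: "kaczmarz_sweep \<gamma> As ps q = q + mat_adjoint A *\<^sub>v y"
    using kaczmarz_sweep_eq[OF ps As \<gamma> q] unfolding A_def by blast
  obtain y' where y': "y' \<in> carrier_vec ?N" "T_mat \<gamma> n As *\<^sub>v y' = stack_vec pts - A *\<^sub>v q'"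
    and sw': "kaczmarz_sweep \<gamma> As pts q' = q' + mat_adjoint A *\<^sub>v y'"
    using kaczmarz_sweep_eq[OF pts As \<gamma> q'] unfolding A_def by blast
  have Aqs: "A *\<^sub>v q \<in> carrier_vec ?N" "A *\<^sub>v q' \<in> carrier_vec ?N" "A *\<^sub>v e \<in> carrier_vec ?N"
    using A q q' e by (auto intro!: mult_mat_vec_carrier)
  have "T_mat \<gamma> n As *\<^sub>v (y' - y) = d - A *\<^sub>v e"
    unfolding mult_minus_distrib_mat_vec[OF T y'(1) y(1)] y y' e_def mult_minus_distrib_mat_vec[OF A q' q] d_def
    by (rule minus_minus_minus_vec[OF s(2) Aqs(2) s(1) Aqs(1)])
  then have "M *\<^sub>v (d - A *\<^sub>v e) = y' - y"
    unfolding M_def using M_mat_props(2)[OF As \<gamma>, of "y' - y" "d - A *\<^sub>v e"] y y' d Aqs by simp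
  then have yy: "y' - y = M *\<^sub>v d - M *\<^sub>v (A *\<^sub>v e)"
    using mult_minus_distrib_mat_vec[OF M d Aqs(3)] by simp
  have Ms: "M *\<^sub>v d \<in> carrier_vec ?N" "M *\<^sub>v (A *\<^sub>v e) \<in> carrier_vec ?N"
    using M d Aqs by (auto intro!: mult_mat_vec_carrier)
  have A's: "mat_adjoint A *\<^sub>v z \<in> carrier_vec n" if "z \<in> carrier_vec ?N" for z
    using A' that by (rule mult_mat_vec_carrier)
  have "kaczmarz_sweep \<gamma> As pts q' - kaczmarz_sweep \<gamma> As ps q
      = e + (mat_adjoint A *\<^sub>v y' - mat_adjoint A *\<^sub>v y)"
    unfolding sw sw' e_def using A q q' A's[OF y(1)] A's[OF y'(1)] by (intro eq_vecI) auto
  also have "mat_adjoint A *\<^sub>v y' - mat_adjoint A *\<^sub>v y = mat_adjoint A *\<^sub>v (y' - y)"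
    by (rule mult_minus_distrib_mat_vec[OF A' y'(1) y(1), symmetric])
  also have "\<dots> = mat_adjoint A *\<^sub>v (M *\<^sub>v d) - mat_adjoint A *\<^sub>v (M *\<^sub>v (A *\<^sub>v e))"
    unfolding yy by (rule mult_minus_distrib_mat_vec[OF A' Ms])
  finally show ?thesis
    unfolding d_def[symmetric] using e A's[OF Ms(1)] A's[OF Ms(2)] by (intro eq_vecI) auto
qed

text \<open>The square root \<open>X\<close> is Hermitian, so the squared norm of
  \<open>X *\<^sub>v y\<close> is the quadratic form of \<open>X * X\<close> at
  \<open>y\<close>.\<close>

lemma R_mat_mult_vec:
  assumes As: "\<forall>B \<in> set As. dim_col B = n" and \<gamma>: "0 < \<gamma>" and x: "x \<in> carrier_vec n"
  shows "R_mat \<gamma> n As \<in> carrier_mat (num_rows As) n"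
    and "(vnorm (R_mat \<gamma> n As *\<^sub>v x))\<^sup>2 = Re ((D_mat (2 * \<gamma>) As *\<^sub>v (M_mat \<gamma> n As *\<^sub>v (stack_mat n As *\<^sub>v x)))
        \<bullet>c (M_mat \<gamma> n As *\<^sub>v (stack_mat n As *\<^sub>v x)))"
proof -
  let ?N = "num_rows As" and ?M = "M_mat \<gamma> n As" and ?A = "stack_mat n As"
  define X where "X = psd_sqrt (D_mat (2 * \<gamma>) As)"
  define y where "y = ?M *\<^sub>v (?A *\<^sub>v x)"
  have pd: "herm_pd (D_mat (2 * \<gamma>) As)" using As \<gamma> by (intro D_mat_herm_pd) auto
  have X: "X \<in> carrier_mat ?N ?N" "herm_pd X" "X * X = D_mat (2 * \<gamma>) As"
    unfolding X_def using psd_sqrt[OF D_mat_carrier pd] by auto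
  have M: "?M \<in> carrier_mat ?N ?N" using M_mat_props(1)[OF As \<gamma>] .
  have A: "?A \<in> carrier_mat ?N n" using As by (rule stack_mat_carrier)
  have XM: "X * ?M \<in> carrier_mat ?N ?N" using X(1) M by (rule mult_carrier_mat)
  show "R_mat \<gamma> n As \<in> carrier_mat ?N n"
    unfolding R_mat_def X_def[symmetric] using XM A by (rule mult_carrier_mat)
  have Ax: "?A *\<^sub>v x \<in> carrier_vec ?N" using A x by (rule mult_mat_vec_carrier)
  have y: "y \<in> carrier_vec ?N" unfolding y_def using M Ax by (rule mult_mat_vec_carrier)
  have Xy: "X *\<^sub>v y \<in> carrier_vec ?N" using X(1) y by (rule mult_mat_vec_carrier)
  have R: "R_mat \<gamma> n As *\<^sub>v x = X *\<^sub>v y"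
    unfolding R_mat_def X_def[symmetric] assoc_mult_mat_vec[OF XM A x] assoc_mult_mat_vec[OF X(1) M Ax] y_def ..
  have "(D_mat (2 * \<gamma>) As *\<^sub>v y) \<bullet>c y = (X *\<^sub>v (X *\<^sub>v y)) \<bullet>c y"
    unfolding X(3)[symmetric] assoc_mult_mat_vec[OF X(1) X(1) y] ..
  also have "\<dots> = (X *\<^sub>v y) \<bullet>c (X *\<^sub>v y)"
    using cscalar_prod_adjoint[OF X(1) Xy y] X(2) by (simp add: herm_pd_def)
  finally show "(vnorm (R_mat \<gamma> n As *\<^sub>v x))\<^sup>2 = Re ((D_mat (2 * \<gamma>) As *\<^sub>v (?M *\<^sub>v (?A *\<^sub>v x))) \<bullet>c (?M *\<^sub>v (?A *\<^sub>v x)))"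
    unfolding R y_def[symmetric] by (simp add: vnorm_sq_Re)
qed

text \<open>With \<open>y\<close> the image of \<open>x\<close> under \<open>M A\<close>, one has
  \<open>T y = A x\<close>, so the cross term in the expanded square is the quadratic form of
  \<open>T\<close> at \<open>y\<close>. Replacing it by \<open>T_mat_quadratic_form\<close> cancels
  the square of \<open>A\<^sup>* y\<close> and leaves the form of \<open>D\<close> at
  \<open>2 * \<gamma>\<close>.\<close>

lemma sweep_contraction_eq:
  assumes As: "\<forall>B \<in> set As. dim_col B = n" and \<gamma>: "0 < \<gamma>" and x: "x \<in> carrier_vec n"
  defines "A \<equiv> stack_mat n As"
  shows "(vnorm (x - mat_adjoint A *\<^sub>v (M_mat \<gamma> n As *\<^sub>v (A *\<^sub>v x))))\<^sup>2
       = (vnorm x)\<^sup>2 - (vnorm (R_mat \<gamma> n As *\<^sub>v x))\<^sup>2"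
proof -
  let ?N = "num_rows As" and ?M = "M_mat \<gamma> n As"
  define y where "y = ?M *\<^sub>v (A *\<^sub>v x)"
  have A: "A \<in> carrier_mat ?N n" unfolding A_def using As by (rule stack_mat_carrier)
  have Ax: "A *\<^sub>v x \<in> carrier_vec ?N" using A x by (rule mult_mat_vec_carrier)
  have y: "y \<in> carrier_vec ?N"
    unfolding y_def using M_mat_props(1)[OF As \<gamma>] Ax by (rule mult_mat_vec_carrier)
  have A'y: "mat_adjoint A *\<^sub>v y \<in> carrier_vec n"
    using A y by (intro mult_mat_vec_carrier[of _ n ?N]) auto
  have Ty: "T_mat \<gamma> n As *\<^sub>v y = A *\<^sub>v x"
    using M_mat_props(2)[OF As \<gamma> y Ax] by (simp add: y_def)
  have "x \<bullet>c (mat_adjoint A *\<^sub>v y) = (T_mat \<gamma> n As *\<^sub>v y) \<bullet>c y"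
    unfolding Ty by (rule cscalar_prod_adjoint[OF A x y, symmetric])
  then have "(vnorm (x - mat_adjoint A *\<^sub>v y))\<^sup>2
      = (vnorm x)\<^sup>2 - 2 * Re ((T_mat \<gamma> n As *\<^sub>v y) \<bullet>c y) + (vnorm (mat_adjoint A *\<^sub>v y))\<^sup>2"
    using vnorm_minus_sq[OF x A'y] by simp
  also have "\<dots> = (vnorm x)\<^sup>2 - Re ((D_mat (2 * \<gamma>) As *\<^sub>v y) \<bullet>c y)"
    unfolding T_mat_quadratic_form[OF As y] A_def by simp
  finally show ?thesis
    using R_mat_mult_vec(2)[OF As \<gamma> x] by (simp add: y_def A_def)
qed

text \<open>The singular value estimate applies because the range of the adjoint of \<open>A\<close>
  is orthogonal to the kernel of \<open>R_mat\<close>: every kernel vector of \<open>R_mat\<close>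
  is also annihilated by \<open>A\<close>.\<close>

lemma sigma_bound:
  assumes As: "\<forall>B \<in> set As. dim_col B = n" and \<gamma>: "0 < \<gamma>" and z: "z \<in> carrier_vec (num_rows As)"
  defines "A \<equiv> stack_mat n As"
  assumes x0: "mat_adjoint A *\<^sub>v z \<noteq> 0\<^sub>v n"
  shows "0 < sigma \<gamma> n As"
    "(sigma \<gamma> n As)\<^sup>2 * (vnorm (mat_adjoint A *\<^sub>v z))\<^sup>2 \<le> (vnorm (R_mat \<gamma> n As *\<^sub>v (mat_adjoint A *\<^sub>v z)))\<^sup>2"
proof -
  let ?N = "num_rows As" and ?M = "M_mat \<gamma> n As" and ?R = "R_mat \<gamma> n As"
  let ?x = "mat_adjoint A *\<^sub>v z"
  have A: "A \<in> carrier_mat ?N n" unfolding A_def using As by (rule stack_mat_carrier)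
  have A': "mat_adjoint A \<in> carrier_mat n ?N" using A by simp
  have x: "?x \<in> carrier_vec n" using A' z by (rule mult_mat_vec_carrier)
  have R: "?R \<in> carrier_mat ?N n" using R_mat_mult_vec(1)[OF As \<gamma> x] .
  have orth: "?x \<bullet>c u = 0" if u: "u \<in> carrier_vec n" and Ru: "?R *\<^sub>v u = 0\<^sub>v ?N" for u
  proof -
    define y where "y = ?M *\<^sub>v (A *\<^sub>v u)"
    have Au: "A *\<^sub>v u \<in> carrier_vec ?N" using A u by (rule mult_mat_vec_carrier)
    have y: "y \<in> carrier_vec ?N"
      unfolding y_def using M_mat_props(1)[OF As \<gamma>] Au by (rule mult_mat_vec_carrier)
    have "Re ((D_mat (2 * \<gamma>) As *\<^sub>v y) \<bullet>c y) = 0"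
      using R_mat_mult_vec(2)[OF As \<gamma> u] unfolding Ru y_def A_def by (simp add: vnorm_def)
    \<comment> \<open>Coercivity turns the vanishing form into \<open>y = 0\<close>, and solving
      back through \<open>T_mat\<close> gives \<open>A *\<^sub>v u = 0\<close>.\<close>
    then have "2 * \<gamma> * (vnorm y)\<^sup>2 \<le> 0"
      using D_mat_coercive[OF As y, of "2 * \<gamma>"] by simp
    then have "vnorm y = 0" using \<gamma> by (simp add: mult_le_0_iff)
    then have y0: "y = 0\<^sub>v ?N" using vnorm_eq_0_iff[OF y] by simp
    have "A *\<^sub>v u = T_mat \<gamma> n As *\<^sub>v y"
      using M_mat_props(2)[OF As \<gamma> y Au] by (simp add: y_def)
    also have "\<dots> = 0\<^sub>v ?N"
      unfolding y0 by (rule mat_mult_zero_vec[OF T_mat_carrier[OF As]])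
    finally show ?thesis
      using cscalar_prod_adjoint[OF A' z u] z by simp
  qed
  show "0 < sigma \<gamma> n As" "(sigma \<gamma> n As)\<^sup>2 * (vnorm ?x)\<^sup>2 \<le> (vnorm (?R *\<^sub>v ?x))\<^sup>2"
    unfolding sigma_def using min_nonzero_singular_value_bound[OF R x x0 orth] by blast+
qed

section \<open>The iterates and the final estimate\<close>

lemma kaczmarz_iter_Suc: "kaczmarz_iter \<gamma> n As ps (Suc k) = kaczmarz_sweep \<gamma> As ps (kaczmarz_iter \<gamma> n As ps k)"
  by (simp add: kaczmarz_iter_def)

lemma kaczmarz_iter_carrier:
  assumes "list_all2 (\<lambda>B p. p \<in> carrier_vec (dim_row B)) As ps"
    and As: "\<forall>B \<in> set As. dim_col B = n" and "0 < \<gamma>"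
  shows "kaczmarz_iter \<gamma> n As ps k \<in> carrier_vec n"
proof (induction k)
  case 0
  show ?case by (simp add: kaczmarz_iter_def)
next
  case (Suc k)
  have "mat_adjoint (stack_mat n As) \<in> carrier_mat n (num_rows As)"
    using stack_mat_carrier[OF As] by simp
  then show ?case
    using kaczmarz_sweep_eq[OF assms Suc] Suc mult_mat_vec_carrier
    by (fastforce simp: kaczmarz_iter_Suc)
qed

theorem theorem3p2:
  fixes \<gamma> :: real and n :: nat and As :: "complex mat list"
    and ps pts :: "complex vec list" and k :: nat
  assumes gamma_pos: "\<gamma> > 0"
    and cols: "\<forall>B \<in> set As. dim_col B = n"
    and full_row_rank: "vec_space.rank (dim_row (stack_mat n As)) (stack_mat n As)
                          = dim_row (stack_mat n As)"
    and len_p: "length ps = length As" and len_pt: "length pts = length As"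
    and dim_p: "\<forall>j < length As. dim_vec (ps ! j) = dim_row (As ! j)"
    and dim_pt: "\<forall>j < length As. dim_vec (pts ! j) = dim_row (As ! j)"
    and k_ge: "k \<ge> 1"
  shows "vnorm (kaczmarz_iter \<gamma> n As pts k - kaczmarz_iter \<gamma> n As ps k)
     \<le> (1 - sqrt (1 - (sigma \<gamma> n As)^2) ^ k) / (1 - sqrt (1 - (sigma \<gamma> n As)^2))
        * vnorm (mat_adjoint (stack_mat n As) *\<^sub>v
                   (M_mat \<gamma> n As *\<^sub>v (stack_vec pts - stack_vec ps)))"
proof -
  let ?N = "num_rows As" and ?A = "stack_mat n As" and ?M = "M_mat \<gamma> n As" and ?\<sigma> = "sigma \<gamma> n As"
  define \<rho> where "\<rho> = sqrt (1 - ?\<sigma>\<^sup>2)"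
  define w where "w = ?M *\<^sub>v (stack_vec pts - stack_vec ps)"
  define c where "c = mat_adjoint ?A *\<^sub>v w"
  define e where "e k = kaczmarz_iter \<gamma> n As pts k - kaczmarz_iter \<gamma> n As ps k" for k
  have ps: "list_all2 (\<lambda>B p. p \<in> carrier_vec (dim_row B)) As ps"
    using len_p dim_p by (auto simp: list_all2_conv_all_nth intro!: carrier_vecI)
  have pts: "list_all2 (\<lambda>B p. p \<in> carrier_vec (dim_row B)) As pts"
    using len_pt dim_pt by (auto simp: list_all2_conv_all_nth intro!: carrier_vecI)
  note As = cols and \<gamma> = gamma_pos
  have A: "?A \<in> carrier_mat ?N n" using As by (rule stack_mat_carrier)
  have A': "mat_adjoint ?A \<in> carrier_mat n ?N" using A by simp
  have M: "?M \<in> carrier_mat ?N ?N" using M_mat_props(1)[OF As \<gamma>] .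
  have w: "w \<in> carrier_vec ?N"
    unfolding w_def using stack_vec_carrier[OF ps] stack_vec_carrier[OF pts]
    by (intro mult_mat_vec_carrier[OF M]) simp
  have c: "c \<in> carrier_vec n" unfolding c_def using A' w by (rule mult_mat_vec_carrier)
  note iter = kaczmarz_iter_carrier[OF ps As \<gamma>] kaczmarz_iter_carrier[OF pts As \<gamma>]
  have e_Suc: "e (Suc k) = (e k - mat_adjoint ?A *\<^sub>v (?M *\<^sub>v (?A *\<^sub>v e k))) + c" for k
    unfolding e_def kaczmarz_iter_Suc c_def w_def by (rule kaczmarz_sweep_diff[OF ps pts As \<gamma> iter])
  \<comment> \<open>The contraction factor is available only on the range of the adjoint of
    \<open>A\<close>. The initial error is zero, and each step changes the error by vectors of that
    range.\<close>
  have e_range: "\<exists>z \<in> carrier_vec ?N. e k = mat_adjoint ?A *\<^sub>v z" for k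
  proof (induction k)
    case 0
    show ?case
      using A' by (intro bexI[of _ "0\<^sub>v ?N"]) (auto simp: e_def kaczmarz_iter_def intro!: eq_vecI)
  next
    case (Suc k)
    then obtain z where z: "z \<in> carrier_vec ?N" and ez: "e k = mat_adjoint ?A *\<^sub>v z" by blast
    have ek: "e k \<in> carrier_vec n" unfolding ez using A' z by (rule mult_mat_vec_carrier)
    define y where "y = ?M *\<^sub>v (?A *\<^sub>v e k)"
    have y: "y \<in> carrier_vec ?N"
      unfolding y_def using A ek by (intro mult_mat_vec_carrier[OF M] mult_mat_vec_carrier[OF A])
    have "e (Suc k) = (e k - mat_adjoint ?A *\<^sub>v y) + mat_adjoint ?A *\<^sub>v w"
      by (simp only: e_Suc y_def c_def)
    also have "\<dots> = mat_adjoint ?A *\<^sub>v (z - y) + mat_adjoint ?A *\<^sub>v w"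
      unfolding mult_minus_distrib_mat_vec[OF A' z y] ez ..
    also have "\<dots> = mat_adjoint ?A *\<^sub>v (z - y + w)"
      using z y w by (intro mult_add_distrib_mat_vec[OF A', symmetric]) auto
    finally show ?case using z y w by (intro bexI[of _ "z - y + w"]) auto
  qed
  have e_carrier: "e k \<in> carrier_vec n" for k
    using iter by (simp add: e_def)
  show ?thesis
  \<comment> \<open>\<open>sigma_bound\<close> needs a nonzero vector of the range. If
    \<open>c\<close> vanishes, all errors are zero; otherwise \<open>c\<close> itself is such a
    vector.\<close>
  proof (cases "c = 0\<^sub>v n")
    case True
    have "e k = 0\<^sub>v n" for k
    proof (induction k)
      case 0
      show ?case by (simp add: e_def kaczmarz_iter_def)
    next
      case (Suc k)
      have "mat_adjoint ?A *\<^sub>v (?M *\<^sub>v (?A *\<^sub>v 0\<^sub>v n)) = 0\<^sub>v n"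
        using A M by (intro eq_vecI) (auto simp: scalar_prod_def)
      then show ?case unfolding e_Suc Suc True by simp
    qed
    then show ?thesis
      unfolding e_def[symmetric] w_def[symmetric] c_def[symmetric] True by (simp add: vnorm_def)
  next
    case False
    have \<sigma>_pos: "0 < ?\<sigma>"
      using sigma_bound(1)[OF As \<gamma> w] False by (simp add: c_def)
    have "?\<sigma>\<^sup>2 * (vnorm c)\<^sup>2 \<le> (vnorm (R_mat \<gamma> n As *\<^sub>v c))\<^sup>2"
      using sigma_bound(2)[OF As \<gamma> w] False by (simp add: c_def)
    \<comment> \<open>The contraction identity at \<open>c\<close> has a square on its left side, so
      \<open>R_mat\<close> does not lengthen \<open>c\<close>.\<close>
    also have "\<dots> \<le> 1 * (vnorm c)\<^sup>2"
      using sweep_contraction_eq[OF As \<gamma> c] zero_le_power2 by (metis diff_ge_0_iff_ge mult_1)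
    finally have \<sigma>_le: "?\<sigma>\<^sup>2 \<le> 1"
      using vnorm_eq_0_iff[OF c] False by (simp add: mult_le_cancel_right)
    \<comment> \<open>Positivity of the singular value gives \<open>\<rho> < 1\<close>, which makes
      the denominator of the bound positive.\<close>
    have \<rho>: "0 \<le> \<rho>" "\<rho> < 1" using \<sigma>_pos \<sigma>_le by (simp_all add: \<rho>_def)
    have step: "vnorm (e k - mat_adjoint ?A *\<^sub>v (?M *\<^sub>v (?A *\<^sub>v e k))) \<le> \<rho> * vnorm (e k)" for k
    proof (rule power2_le_imp_le)
      have "?\<sigma>\<^sup>2 * (vnorm (e k))\<^sup>2 \<le> (vnorm (R_mat \<gamma> n As *\<^sub>v e k))\<^sup>2"
      proof (cases "e k = 0\<^sub>v n")
        case True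
        then show ?thesis by (simp add: vnorm_def[of "0\<^sub>v n"])
      next
        case False
        obtain z where "z \<in> carrier_vec ?N" "e k = mat_adjoint ?A *\<^sub>v z" using e_range by blast
        with False show ?thesis using sigma_bound(2)[OF As \<gamma>, of z] by simp
      qed
      then show "(vnorm (e k - mat_adjoint ?A *\<^sub>v (?M *\<^sub>v (?A *\<^sub>v e k))))\<^sup>2 \<le> (\<rho> * vnorm (e k))\<^sup>2"
        unfolding sweep_contraction_eq[OF As \<gamma> e_carrier] using \<sigma>_le
        by (simp add: \<rho>_def power_mult_distrib algebra_simps)
    qed (use \<rho> in simp)
    \<comment> \<open>A geometric sum: each step multiplies the old bound by \<open>\<rho>\<close>
      and adds \<open>vnorm c\<close>. The induction starts at \<open>k = 0\<close>, where both
      sides vanish.\<close>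
    have "vnorm (e k) \<le> (1 - \<rho> ^ k) / (1 - \<rho>) * vnorm c" for k
    proof (induction k)
      case 0
      show ?case by (simp add: e_def kaczmarz_iter_def vnorm_def)
    next
      case (Suc k)
      have "mat_adjoint ?A *\<^sub>v (?M *\<^sub>v (?A *\<^sub>v e k)) \<in> carrier_vec n"
        using e_carrier by (intro mult_mat_vec_carrier[OF A'] mult_mat_vec_carrier[OF M] mult_mat_vec_carrier[OF A])
      then have "vnorm (e (Suc k)) \<le> vnorm (e k - mat_adjoint ?A *\<^sub>v (?M *\<^sub>v (?A *\<^sub>v e k))) + vnorm c"
        unfolding e_Suc using e_carrier c by (intro vnorm_triangle[of _ n]) auto
      also have "\<dots> \<le> \<rho> * ((1 - \<rho> ^ k) / (1 - \<rho>) * vnorm c) + vnorm c"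
        using step[of k] mult_left_mono[OF Suc \<rho>(1)] by linarith
      also have "\<dots> = (1 - \<rho> ^ Suc k) / (1 - \<rho>) * vnorm c"
        using \<rho>(2) by (simp add: field_simps)
      finally show ?case .
    qed
    then show ?thesis unfolding e_def c_def w_def \<rho>_def .
  qed
qed

end
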